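(* Let $d\geq 2$, $1\leq q,r\leq\infty$, and let $\varepsilon>0$ be a fixed (small) constant. Suppose that there exists a constant $C>0$ such that $$\big\|e^{it|\nabla|}f\; e^{it\Delta}g\big\|_{L^q_tL^r_x(\mathbb{R}^{1+d})}\leq C\|f\|_{L^2(\mathbb{R}^d)}\|g\|_{L^2(\mathbb{R}^d)}$$ for all $f,g\in L^2(\mathbb{R}^d)$ with $$\operatorname{supp}\widehat{f}\subset\{\xi : |\xi-e_1|\leq\varepsilon\},\qquad \operatorname{supp}\widehat{g}\subset\{\xi : |2\xi+e_1+e_2|\leq\varepsilon\}.$$ Then $$\frac{2}{q}+\frac{d-1}{r}+\frac{1}{2r}\leq d.$$
   Context: $\widehat{f}$ denotes the spatial Fourier transform on $\mathbb{R}^d$, and $e_1,\dots,e_d$ are the standard basis vectors of $\mathbb{R}^d$. The wave propagator $e^{it|\nabla|}$ and the Schrödinger propagator $e^{it\Delta}$ are the Fourier multipliers with symbols $e^{it|\xi|}$ and $e^{-it|\xi|^2}$ respectively. The norm is $\|F\|_{L^q_tL^r_x(\mathbb{R}^{1+d})}=\big\|\,\|F(t,\cdot)\|_{L^r_x(\mathbb{R}^d)}\big\|_{L^q_t(\mathbb{R})}$, with the convention $1/\infty=0$. *)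

theory Defs
  imports "HOL-Probability.Essential_Supremum"
begin

text \<open>Elements of $L^p$ are represented by Borel functions; every class of Lebesgue measurable
  functions modulo null sets contains one. Norms take values in \<^typ>\<open>ennreal\<close>, and the exponent
  \<open>p \<ge> 1\<close> is an \<^typ>\<open>ennreal\<close> with \<open>p = \<infinity>\<close> allowed; there \<open>1 / \<infinity> = 0\<close>.\<close>

text \<open>Real powers on $[0,\infty]$, meant for exponents \<open>a > 0\<close>.\<close>

definition ennpowr :: "ennreal \<Rightarrow> real \<Rightarrow> ennreal" where
  "ennpowr x a = (if x = \<infinity> then \<infinity> else ennreal (enn2real x powr a))"

definition Lp_norm :: "ennreal \<Rightarrow> 'a measure \<Rightarrow> ('a \<Rightarrow> ennreal) \<Rightarrow> ennreal" where
  "Lp_norm p M h =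
     (if p = \<infinity> then esssup M h
      else ennpowr (\<integral>\<^sup>+x. ennpowr (h x) (enn2real p) \<partial>M) (1 / enn2real p))"

definition L2_norm :: "('a::euclidean_space \<Rightarrow> complex) \<Rightarrow> ennreal" where
  "L2_norm f = Lp_norm 2 lborel (\<lambda>x. ennreal (norm (f x)))"

definition L2_fun :: "('a::euclidean_space \<Rightarrow> complex) \<Rightarrow> bool" where
  "L2_fun f \<longleftrightarrow> f \<in> borel_measurable lborel \<and> L2_norm f < \<infinity>"

definition mixed_norm ::
  "ennreal \<Rightarrow> ennreal \<Rightarrow> (real \<Rightarrow> 'a::euclidean_space \<Rightarrow> complex) \<Rightarrow> ennreal" where
  "mixed_norm q r F =
     Lp_norm q lborel (\<lambda>t. Lp_norm r lborel (\<lambda>x. ennreal (norm (F t x))))"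

definition fourier_integral ::
  "('a::euclidean_space \<Rightarrow> complex) \<Rightarrow> 'a \<Rightarrow> complex" where
  "fourier_integral f \<xi> = (\<integral>x. cis (- (x \<bullet> \<xi>)) * f x \<partial>lborel)"

text \<open>On $L^2$ the Fourier transform is the $L^2$-limit of the integrals over the balls
  $|x| \le n$ (Plancherel). Without a factor $2\pi$ in the phase, the symbols of $|\nabla|$ and
  $-\Delta$ are $|\xi|$ and $|\xi|^2$. The limit is unique up to null sets; a representative is
  chosen.\<close>

definition is_L2_fourier ::
  "('a::euclidean_space \<Rightarrow> complex) \<Rightarrow> ('a \<Rightarrow> complex) \<Rightarrow> bool" where
  "is_L2_fourier f G \<longleftrightarrow> L2_fun G \<and>
     (\<lambda>n. L2_norm (\<lambda>\<xi>. fourier_integral (\<lambda>x. indicator (cball 0 (real n)) x * f x) \<xi> - G \<xi>))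
       \<longlonglongrightarrow> 0"

definition L2_fourier :: "('a::euclidean_space \<Rightarrow> complex) \<Rightarrow> 'a \<Rightarrow> complex" where
  "L2_fourier f = (SOME G. is_L2_fourier f G)"

text \<open>Support of a function defined up to null sets, i.e. its support as a distribution.\<close>

definition ess_support :: "('a::euclidean_space \<Rightarrow> complex) \<Rightarrow> 'a set" where
  "ess_support G = - \<Union>{U. open U \<and> (AE \<xi> in lborel. \<xi> \<in> U \<longrightarrow> G \<xi> = 0)}"

text \<open>The multiplier operator with a bounded measurable symbol \<open>m\<close>, on $L^2$. Its value is unique
  up to null sets, hence so are the \<open>x\<close>-norms, at each fixed time, of products of the propagators
  below.\<close>

definition fourier_multiplier ::
  "('a::euclidean_space \<Rightarrow> complex) \<Rightarrow> ('a \<Rightarrow> complex) \<Rightarrow> 'a \<Rightarrow> complex" where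
  "fourier_multiplier m f =
     (SOME h. L2_fun h \<and> (AE \<xi> in lborel. L2_fourier h \<xi> = m \<xi> * L2_fourier f \<xi>))"

definition wave_propagator ::
  "real \<Rightarrow> ('a::euclidean_space \<Rightarrow> complex) \<Rightarrow> 'a \<Rightarrow> complex" where
  "wave_propagator t = fourier_multiplier (\<lambda>\<xi>. cis (t * norm \<xi>))"

definition schroedinger_propagator ::
  "real \<Rightarrow> ('a::euclidean_space \<Rightarrow> complex) \<Rightarrow> 'a \<Rightarrow> complex" where
  "schroedinger_propagator t = fourier_multiplier (\<lambda>\<xi>. cis (- (t * (norm \<xi>)\<^sup>2)))"

end

theory Submission
  imports Defs "HOL-Probability.Characteristic_Functions"
begin

text \<open>
  The condition comes from one family of test data, indexed by a scale \<open>\<rho> \<ge> 1\<close>. Let the Fourier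
  transforms of the two data be the indicators of sets \<open>A\<close> and \<open>B\<close>, write \<open>i\<close>, \<open>j\<close> for the two
  distinguished coordinates and \<open>d\<close> for the dimension, and look at the solutions in the frame
  \<open>y = x + t e_i\<close> that moves with the wave. Their phases are then

    \<open>y \<bullet> \<xi> + t (|\<xi>| - \<xi>_i)\<close>  and  \<open>y \<bullet> \<eta> - t (|\<eta>|^2 + \<eta>_i)\<close>.

  The cone is flat in the radial direction: on a box \<open>A\<close> around \<open>e_i\<close> of width \<open>1 / \<rho>\<close> in the
  direction \<open>i\<close> and \<open>1 / \<rho>^2\<close> in all others, \<open>|\<xi>| - \<xi>_i\<close> is of size \<open>1 / \<rho>^4\<close>. For
  \<open>\<eta> = - (e_i + e_j) / 2 + a e_i + b e_j + \<eta>'\<close> one finds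
  \<open>|\<eta>|^2 + \<eta>_i = a^2 - b + b^2 + |\<eta>'|^2\<close>: the linear term in \<open>a\<close> is absent because the two group
  velocities \<open>- e_i\<close> and \<open>- e_i - e_j\<close> differ only in the direction \<open>j\<close>. Hence \<open>B\<close> may be taken as
  wide as \<open>A\<close> in the direction \<open>i\<close>, provided that it is bent along the parabola \<open>b = a^2\<close>, with
  thickness \<open>1 / \<rho>^4\<close>, and has width \<open>1 / \<rho>^2\<close> in the remaining directions. With small constants in
  front of these widths both phases vary by at most 1 as long as \<open>|y_i| \<le> \<rho>\<close>,
  \<open>|y_k| \<le> \<rho>^2\<close> for \<open>k \<noteq> i\<close> and \<open>0 \<le> t \<le> \<rho>^4\<close> (\<open>wave_phase\<close>, \<open>schroedinger_phase\<close>). There the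
  two solutions have size at least a constant times \<open>|A|\<close> and \<open>|B|\<close>, whereas the data have norm at
  most \<open>|A|^(1/2)\<close> and \<open>|B|^(1/2)\<close>. So the assumed estimate bounds
  \<open>(|A| |B|)^(1/2) \<rho>^(4/q) \<rho>^((2d-1)/r)\<close> uniformly (\<open>bilinear_estimate_test\<close>). Since \<open>|A| |B|\<close> is
  comparable to \<open>\<rho>^(-4d)\<close>, letting \<open>\<rho>\<close> grow gives \<open>4/q + (2d-1)/r \<le> 2d\<close>, which is the claim. If
  \<open>q\<close> or \<open>r\<close> is infinite the claim is elementary.

  The propagators are given by the multiplier operator on square integrable functions, that is, by a
  choice among functions characterised through their Fourier transforms. To compute with them one
  needs the formula of \<open>fourier_multiplier_AE\<close>, which evaluates the multiplier almost everywhere as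
  an inverse Fourier integral. It rests on four facts: the bound
  \<open>fourier_integral_energy_le\<close>, which extends the Fourier transform from integrable functions;
  completeness (\<open>energy_complete\<close>), which makes this extension exist; the multiplication formula
  \<open>\<integral> F(f) g = \<integral> f F(g)\<close>, where \<open>F\<close> is the Fourier transform (\<open>is_L2_fourier_mult\<close>); and the
  fact that Gaussians separate square integrable functions (\<open>AE_zero_if_gauss_integrals_zero\<close>).
  Tested on Gaussians, whose transforms are explicit, the multiplication formula yields both Fourier
  inversion and injectivity.
\<close>

section \<open>Fourier transforms of Gaussians\<close>

lemma borel_measurable_cis [measurable (raw)]:
  "f \<in> borel_measurable M \<Longrightarrow> (\<lambda>x. cis (f x)) \<in> borel_measurable M"
  by (rule measurable_compose[where g = cis], assumption)
     (intro borel_measurable_continuous_onI continuous_intros)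

text \<open>This is the characteristic function of the standard normal distribution, rescaled.\<close>

lemma gaussian_fourier_real:
  fixes s z :: real
  assumes s: "s > 0"
  shows "integrable lborel (\<lambda>x. cis (- (x * z)) * complex_of_real (exp (- (s * x\<^sup>2 / 2))))"
    and "(\<integral>x. cis (- (x * z)) * complex_of_real (exp (- (s * x\<^sup>2 / 2))) \<partial>lborel)
      = complex_of_real (sqrt (2 * pi / s) * exp (- (z\<^sup>2 / (2 * s))))"
proof -
  define c where "c = sqrt s"
  have c: "c > 0" "c\<^sup>2 = s" using s by (auto simp: c_def)
  define w where "w = - (z / c)"
  let ?f = "\<lambda>x::real. cis (w * x) * complex_of_real (exp (- (x\<^sup>2 / 2)))"
  have dens: "std_normal_density x * sqrt (2 * pi) = exp (- (x\<^sup>2 / 2))" for x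
    by (simp add: std_normal_density_def)
  have int0: "integrable lborel (\<lambda>x::real. exp (- (x\<^sup>2 / 2)))"
    using integrable_mult_left[OF integrable_normal_density[of 1 0], of "sqrt (2 * pi)"]
    by (simp add: dens)
  have intf: "integrable lborel ?f"
    by (rule Bochner_Integration.integrable_bound[OF int0]) (auto simp: norm_mult)
  have "complex_of_real (exp (- (w\<^sup>2) / 2)) = char std_normal_distribution w"
    by (simp add: char_std_normal_distribution)
  also have "\<dots> = (\<integral>x. std_normal_density x *\<^sub>R iexp (w * x) \<partial>lborel)"
    unfolding char_def by (subst integral_density) (auto intro: normal_density_nonneg)
  finally have ch: "(\<integral>x. std_normal_density x *\<^sub>R iexp (w * x) \<partial>lborel) = complex_of_real (exp (- (w\<^sup>2) / 2))" ..
  have "(\<integral>x. ?f x \<partial>lborel) = (\<integral>x. complex_of_real (sqrt (2 * pi)) * (std_normal_density x *\<^sub>R iexp (w * x)) \<partial>lborel)"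
    by (rule Bochner_Integration.integral_cong)
       (auto simp: dens[symmetric] cis_conv_exp scaleR_conv_of_real mult_ac)
  also have "\<dots> = complex_of_real (sqrt (2 * pi)) * complex_of_real (exp (- (w\<^sup>2) / 2))"
    by (subst integral_mult_right_zero) (simp only: ch)
  finally have If: "(\<integral>x. ?f x \<partial>lborel) = complex_of_real (sqrt (2 * pi) * exp (- (w\<^sup>2) / 2))" by simp
  have eq: "?f (0 + c * x) = cis (- (x * z)) * complex_of_real (exp (- (s * x\<^sup>2 / 2)))" for x
    using c by (simp add: w_def power_mult_distrib mult_ac)
  show "integrable lborel (\<lambda>x. cis (- (x * z)) * complex_of_real (exp (- (s * x\<^sup>2 / 2))))"
    using lborel_integrable_real_affine[OF intf, of c 0] c unfolding eq by simp
  have "(\<integral>x. ?f x \<partial>lborel) = \<bar>c\<bar> *\<^sub>R (\<integral>x. ?f (0 + c * x) \<partial>lborel)"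
    using c by (intro lborel_integral_real_affine) simp
  then have "(\<integral>x. cis (- (x * z)) * complex_of_real (exp (- (s * x\<^sup>2 / 2))) \<partial>lborel)
     = (1 / c) *\<^sub>R complex_of_real (sqrt (2 * pi) * exp (- (w\<^sup>2) / 2))"
    unfolding eq If using c by (simp add: field_simps)
  also have "\<dots> = complex_of_real (sqrt (2 * pi / s) * exp (- (z\<^sup>2 / (2 * s))))"
    using c by (simp add: w_def scaleR_conv_of_real real_sqrt_divide c_def power_divide mult_ac)
  finally show "(\<integral>x. cis (- (x * z)) * complex_of_real (exp (- (s * x\<^sup>2 / 2))) \<partial>lborel)
      = complex_of_real (sqrt (2 * pi / s) * exp (- (z\<^sup>2 / (2 * s))))" .
qed

text \<open>The Gaussian with centre \<open>a\<close> and inverse variance \<open>s\<close>, normalised to be 1 at its centre.\<close>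

definition gauss :: "real \<Rightarrow> 'a::euclidean_space \<Rightarrow> 'a \<Rightarrow> real" where
  "gauss s a x = exp (- (s * (norm (x - a))\<^sup>2 / 2))"

lemma gauss_pos: "gauss s a x > 0" by (simp add: gauss_def)
lemma gauss_nonneg [simp]: "gauss s a x \<ge> 0" by (simp add: gauss_def)
lemma gauss_le_1: "s \<ge> 0 \<Longrightarrow> gauss s a x \<le> 1" by (simp add: gauss_def)

lemma gauss_measurable [measurable]: "gauss s a \<in> borel_measurable borel"
  unfolding gauss_def by measurable

lemma gauss_commute: "gauss s a x = gauss s x a"
  by (simp add: gauss_def norm_minus_commute)

text \<open>Both the Gaussian and the exponential factor over the coordinates, so the integral is a product of one-dimensional ones.\<close>

lemma gauss_centred_fourier:
  fixes z :: "'a::euclidean_space"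
  assumes s: "s > 0"
  shows "integrable lborel (\<lambda>x. cis (- (x \<bullet> z)) * complex_of_real (gauss s 0 x))"
    and "fourier_integral (\<lambda>x. complex_of_real (gauss s 0 x)) z
      = complex_of_real (sqrt (2 * pi / s) ^ DIM('a) * gauss (1 / s) 0 z)"
proof -
  interpret product_sigma_finite "\<lambda>_::'a. lborel :: real measure" ..
  define F where "F b x = cis (- (x * (z \<bullet> b))) * complex_of_real (exp (- (s * x\<^sup>2 / 2)))" for b :: 'a and x :: real
  have exps: "(\<Prod>b\<in>Basis. exp (h b)) = exp (\<Sum>b\<in>Basis. h b)" for h :: "'a \<Rightarrow> real"
    by (simp add: exp_sum)
  have ciss: "(\<Prod>b\<in>Basis. cis (h b)) = cis (\<Sum>b\<in>Basis. h b)" for h :: "'a \<Rightarrow> real"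
    by (simp add: cis_conv_exp exp_sum sum_distrib_left)
  have nrm: "(norm x)\<^sup>2 = (\<Sum>b\<in>Basis. (x \<bullet> b)\<^sup>2)" for x :: 'a
    unfolding power2_norm_eq_inner by (subst euclidean_inner) (simp add: power2_eq_square)
  have F: "cis (- (x \<bullet> z)) * complex_of_real (gauss s 0 x) = (\<Prod>b\<in>Basis. F b (x \<bullet> b))" for x
    unfolding F_def prod.distrib of_real_prod[symmetric] exps ciss gauss_def
    by (simp add: nrm sum_negf sum_distrib_left sum_divide_distrib euclidean_inner[of x z])
  let ?S = "\<lambda>f. \<Sum>b\<in>Basis. f b *\<^sub>R b :: 'a"
  have S: "(\<Prod>b\<in>Basis. F b (?S f \<bullet> b)) = (\<Prod>b\<in>Basis. F b (f b))" for f
    by (rule prod.cong) auto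
  have Fint: "integrable lborel (F b)" for b
    unfolding F_def by (rule gaussian_fourier_real(1)[OF s])
  have [measurable]: "F b \<in> borel_measurable borel" for b
    using Fint[of b] by simp
  show "integrable lborel (\<lambda>x. cis (- (x \<bullet> z)) * complex_of_real (gauss s 0 x))"
    unfolding F lborel_def
    by (subst integrable_distr_eq) (auto simp: S simp flip: lborel_eq_real intro!: product_integrable_prod Fint)
  have "fourier_integral (\<lambda>x. complex_of_real (gauss s 0 x)) z = (\<integral>x. (\<Prod>b\<in>Basis. F b (x \<bullet> b)) \<partial>lborel)"
    unfolding fourier_integral_def F ..
  also have "\<dots> = (\<Prod>b\<in>Basis. \<integral>x. F b x \<partial>lborel)"
    by (subst lborel_def, subst integral_distr) (auto simp: S simp flip: lborel_eq_real intro!: product_integral_prod Fint)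
  also have "\<dots> = (\<Prod>b\<in>Basis. complex_of_real (sqrt (2 * pi / s) * exp (- ((z \<bullet> b)\<^sup>2 / (2 * s)))))"
    unfolding F_def by (rule prod.cong) (auto simp: gaussian_fourier_real(2)[OF s])
  also have "\<dots> = complex_of_real (sqrt (2 * pi / s) ^ DIM('a) * gauss (1 / s) 0 z)"
    unfolding of_real_prod[symmetric] prod.distrib exps
    by (simp add: gauss_def nrm sum_negf sum_divide_distrib mult.commute[of s 2])
  finally show "fourier_integral (\<lambda>x. complex_of_real (gauss s 0 x)) z
      = complex_of_real (sqrt (2 * pi / s) ^ DIM('a) * gauss (1 / s) 0 z)" .
qed

section \<open>The Fourier integral of an integrable function\<close>

lemma borel_measurable_cnj [measurable (raw)]:
  "f \<in> borel_measurable M \<Longrightarrow> (\<lambda>x. cnj (f x)) \<in> borel_measurable M"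
  by (rule measurable_compose[where g = cnj], assumption)
     (intro borel_measurable_continuous_onI continuous_intros)

text \<open>With \<open>c = 1\<close> and \<open>c = -1\<close> this covers translations and point reflections.\<close>

lemma lborel_distr_affine_isometry:
  fixes t :: "'a::euclidean_space"
  assumes "\<bar>c\<bar> = 1"
  shows "distr lborel borel (\<lambda>x. t + c *\<^sub>R x) = (lborel :: 'a measure)"
  using lborel_affine[of c t] assms by (auto simp: density_1)

lemma
  fixes t :: "'a::euclidean_space" and h :: "'a \<Rightarrow> 'b::{banach, second_countable_topology}"
  assumes c: "\<bar>c\<bar> = 1"
  shows nn_integral_affine_isometry:
      "f \<in> borel_measurable borel \<Longrightarrow> (\<integral>\<^sup>+x. f (t + c *\<^sub>R x) \<partial>lborel) = (\<integral>\<^sup>+x. f x \<partial>lborel)"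
    and integral_affine_isometry:
      "h \<in> borel_measurable borel \<Longrightarrow> (\<integral>x. h (t + c *\<^sub>R x) \<partial>lborel) = (\<integral>x. h x \<partial>lborel)"
    and integrable_affine_isometry:
      "h \<in> borel_measurable borel \<Longrightarrow>
        integrable lborel (\<lambda>x. h (t + c *\<^sub>R x)) \<longleftrightarrow> integrable lborel h"
proof -
  note T = lborel_distr_affine_isometry[OF c, of t, symmetric]
  show "f \<in> borel_measurable borel \<Longrightarrow> (\<integral>\<^sup>+x. f (t + c *\<^sub>R x) \<partial>lborel) = (\<integral>\<^sup>+x. f x \<partial>lborel)"
    by (subst (2) T) (simp add: nn_integral_distr)
  show "h \<in> borel_measurable borel \<Longrightarrow> (\<integral>x. h (t + c *\<^sub>R x) \<partial>lborel) = (\<integral>x. h x \<partial>lborel)"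
    by (subst (2) T) (simp add: integral_distr)
  show "h \<in> borel_measurable borel \<Longrightarrow>
      integrable lborel (\<lambda>x. h (t + c *\<^sub>R x)) \<longleftrightarrow> integrable lborel h"
    by (subst (2) T) (simp add: integrable_distr_eq)
qed

lemma fourier_integral_measurable [measurable]:
  assumes [measurable]: "f \<in> borel_measurable borel"
  shows "fourier_integral f \<in> borel_measurable borel"
  unfolding fourier_integral_def by measurable

lemma norm_fourier_integral_le:
  "norm (fourier_integral f \<xi>) \<le> (\<integral>x. norm (f x) \<partial>lborel)"
  unfolding fourier_integral_def
  by (rule order_trans[OF integral_norm_bound]) (simp add: norm_mult)

lemma integrable_cis_mult:
  fixes f :: "'a::euclidean_space \<Rightarrow> complex"
  assumes f: "integrable lborel f" and [measurable]: "h \<in> borel_measurable borel"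
  shows "integrable lborel (\<lambda>x. cis (h x) * f x)"
proof -
  have [measurable]: "f \<in> borel_measurable borel" using f by auto
  show ?thesis
    by (rule Bochner_Integration.integrable_bound[OF f]) (auto simp: norm_mult)
qed

text \<open>The kernel of the Fourier integral is symmetric and bounded, so Fubini's theorem moves it from one factor to the other.\<close>

lemma fourier_integral_mult:
  fixes f g :: "'a::euclidean_space \<Rightarrow> complex"
  assumes f: "integrable lborel f" and g: "integrable lborel g"
  shows "(\<integral>\<xi>. fourier_integral f \<xi> * g \<xi> \<partial>lborel) = (\<integral>x. f x * fourier_integral g x \<partial>lborel)"
proof -
  have [measurable]: "f \<in> borel_measurable borel" "g \<in> borel_measurable borel" using f g by auto
  have "integrable (lborel \<Otimes>\<^sub>M lborel) (case_prod (\<lambda>x \<xi>. cis (- (x \<bullet> \<xi>)) * f x * g \<xi>))"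
  proof (rule lborel_pair.Fubini_integrable)
    show "integrable lborel (\<lambda>x. \<integral>\<xi>. norm (case (x, \<xi>) of (x, \<xi>) \<Rightarrow> cis (- (x \<bullet> \<xi>)) * f x * g \<xi>) \<partial>lborel)"
      using f g by (simp add: norm_mult)
    show "AE x in lborel. integrable lborel (\<lambda>\<xi>. case (x, \<xi>) of (x, \<xi>) \<Rightarrow> cis (- (x \<bullet> \<xi>)) * f x * g \<xi>)"
      using integrable_cis_mult[OF integrable_mult_right[OF g]] by (simp add: mult_ac)
  qed measurable
  from lborel_pair.Fubini_integral[OF this]
  have "(\<integral>\<xi>. (\<integral>x. cis (- (x \<bullet> \<xi>)) * f x * g \<xi> \<partial>lborel) \<partial>lborel) = (\<integral>x. (\<integral>\<xi>. f x * (cis (- (\<xi> \<bullet> x)) * g \<xi>) \<partial>lborel) \<partial>lborel)"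
    by (simp add: inner_commute mult_ac)
  then show ?thesis
    unfolding fourier_integral_def by simp
qed

lemma gauss_eq_centred: "gauss s a (a + x) = gauss s 0 x"
  by (simp add: gauss_def)

lemma
  fixes a b :: "'a::euclidean_space"
  assumes s: "s > 0"
  shows gauss_integrable: "integrable lborel (gauss s a)"
    and gauss_integral: "(\<integral>x. gauss s a x \<partial>lborel) = sqrt (2 * pi / s) ^ DIM('a)"
    and modulated_gauss_integrable: "integrable lborel (\<lambda>x. cis (x \<bullet> b) * complex_of_real (gauss s a x))"
    and fourier_modulated_gauss: "fourier_integral (\<lambda>x. cis (x \<bullet> b) * complex_of_real (gauss s a x)) \<xi>
      = cis (a \<bullet> (b - \<xi>)) * complex_of_real (sqrt (2 * pi / s) ^ DIM('a) * gauss (1 / s) b \<xi>)"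
proof -
  have shift: "integrable lborel (\<lambda>x. h x) \<longleftrightarrow> integrable lborel (\<lambda>x. h (a + x))"
    "h \<in> borel_measurable borel \<Longrightarrow> (\<integral>x. h x \<partial>lborel) = (\<integral>x. h (a + x) \<partial>lborel)"
    if "h \<in> borel_measurable borel" for h :: "'a \<Rightarrow> complex"
    using integrable_affine_isometry[of 1 h a] integral_affine_isometry[of 1 h a] that by simp_all
  have c: "integrable lborel (\<lambda>x. complex_of_real (gauss s a x))"
    using gauss_centred_fourier(1)[OF s, of 0] by (subst shift) (auto simp: gauss_eq_centred)
  from integrable_Re[OF this] show i: "integrable lborel (gauss s a)"
    by simp
  have "complex_of_real (\<integral>x. gauss s a x \<partial>lborel) = (\<integral>x. complex_of_real (gauss s a x) \<partial>lborel)"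
    by simp
  also have "\<dots> = complex_of_real (sqrt (2 * pi / s) ^ DIM('a))"
    using gauss_centred_fourier(2)[OF s, of 0]
    by (subst shift) (auto simp: gauss_eq_centred fourier_integral_def gauss_def)
  finally show "(\<integral>x. gauss s a x \<partial>lborel) = sqrt (2 * pi / s) ^ DIM('a)"
    using of_real_eq_iff by blast
  show "integrable lborel (\<lambda>x. cis (x \<bullet> b) * complex_of_real (gauss s a x))"
    by (rule integrable_cis_mult[OF c]) simp
  have "fourier_integral (\<lambda>x. cis (x \<bullet> b) * complex_of_real (gauss s a x)) \<xi>
      = (\<integral>x. cis (x \<bullet> (b - \<xi>)) * complex_of_real (gauss s a x) \<partial>lborel)"
    by (simp add: fourier_integral_def mult.assoc[symmetric] cis_mult inner_diff_right)
  also have "\<dots> = (\<integral>x. cis (a \<bullet> (b - \<xi>)) * (cis (- (x \<bullet> (\<xi> - b))) * complex_of_real (gauss s 0 x)) \<partial>lborel)"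
    by (subst shift) (auto simp: gauss_eq_centred inner_add_left mult.assoc[symmetric] cis_mult inner_diff_right add_diff_add)
  also have "\<dots> = cis (a \<bullet> (b - \<xi>)) * fourier_integral (\<lambda>x. complex_of_real (gauss s 0 x)) (\<xi> - b)"
    by (simp add: fourier_integral_def)
  also have "fourier_integral (\<lambda>x. complex_of_real (gauss s 0 x)) (\<xi> - b)
      = complex_of_real (sqrt (2 * pi / s) ^ DIM('a) * gauss (1 / s) b \<xi>)"
    by (simp only: gauss_centred_fourier(2)[OF s]) (simp add: gauss_def)
  finally show "fourier_integral (\<lambda>x. cis (x \<bullet> b) * complex_of_real (gauss s a x)) \<xi>
      = cis (a \<bullet> (b - \<xi>)) * complex_of_real (sqrt (2 * pi / s) ^ DIM('a) * gauss (1 / s) b \<xi>)" .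
qed

text \<open>The transform of a Gaussian with parameter \<open>s\<close> is a multiple of one with parameter \<open>1 / s\<close>. These are the two normalising constants, whose product is the constant of Fourier inversion.\<close>

lemma gauss_mass_mult: "s > 0 \<Longrightarrow> sqrt (2 * pi / s) ^ n * sqrt (2 * pi / (1 / s)) ^ n = (2 * pi) ^ n"
proof -
  assume s: "s > 0"
  have "sqrt (2 * pi / s) * sqrt (2 * pi / (1 / s)) = sqrt ((2 * pi)\<^sup>2)"
    using s by (simp add: power2_eq_square flip: real_sqrt_mult)
  also have "\<dots> = 2 * pi"
    by (simp only: real_sqrt_abs) simp
  finally show ?thesis by (simp only: power_mult_distrib[symmetric])
qed

text \<open>The square of the norm \<open>L2_norm\<close>, see \<open>L2_norm_power2\<close>; it avoids roots in the estimates.\<close>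

definition energy :: "('a::euclidean_space \<Rightarrow> complex) \<Rightarrow> ennreal" where
  "energy f = (\<integral>\<^sup>+x. ennreal ((norm (f x))\<^sup>2) \<partial>lborel)"

text \<open>Schur's test for a symmetric kernel: bound \<open>2 a(x) a(y)\<close> by \<open>a(x)^2 + a(y)^2\<close>; by symmetry both terms contribute the same.\<close>

lemma schur_symmetric:
  fixes a :: "'a::euclidean_space \<Rightarrow> real" and k :: "'a \<Rightarrow> 'a \<Rightarrow> real"
  assumes [measurable]: "a \<in> borel_measurable borel" "case_prod k \<in> borel_measurable (borel \<Otimes>\<^sub>M borel)"
    and k: "\<And>x y. k x y \<ge> 0" "\<And>x y. k x y = k y x" "\<And>x. (\<integral>\<^sup>+y. ennreal (k x y) \<partial>lborel) \<le> \<kappa>"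
  shows "(\<integral>\<^sup>+x. \<integral>\<^sup>+y. ennreal (a x * a y * k x y) \<partial>lborel \<partial>lborel)
    \<le> \<kappa> * (\<integral>\<^sup>+x. ennreal ((a x)\<^sup>2) \<partial>lborel)"
proof -
  let ?E = "\<integral>\<^sup>+x. ennreal ((a x)\<^sup>2) \<partial>lborel"
  let ?P = "\<integral>\<^sup>+x. \<integral>\<^sup>+y. ennreal (a x * a y * k x y) \<partial>lborel \<partial>lborel"
  have A: "(\<integral>\<^sup>+x. \<integral>\<^sup>+y. ennreal ((a x)\<^sup>2) * ennreal (k x y) \<partial>lborel \<partial>lborel) \<le> \<kappa> * ?E"
  proof -
    have "(\<integral>\<^sup>+x. \<integral>\<^sup>+y. ennreal ((a x)\<^sup>2) * ennreal (k x y) \<partial>lborel \<partial>lborel)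
      = (\<integral>\<^sup>+x. ennreal ((a x)\<^sup>2) * (\<integral>\<^sup>+y. ennreal (k x y) \<partial>lborel) \<partial>lborel)"
      by (intro nn_integral_cong nn_integral_cmult) measurable
    also have "\<dots> \<le> (\<integral>\<^sup>+x. \<kappa> * ennreal ((a x)\<^sup>2) \<partial>lborel)"
      by (intro nn_integral_mono, subst mult.commute) (intro mult_right_mono k(3), simp)
    finally show ?thesis by (simp add: nn_integral_cmult)
  qed
  have B: "(\<integral>\<^sup>+x. \<integral>\<^sup>+y. ennreal ((a y)\<^sup>2) * ennreal (k x y) \<partial>lborel \<partial>lborel)
    = (\<integral>\<^sup>+x. \<integral>\<^sup>+y. ennreal ((a x)\<^sup>2) * ennreal (k x y) \<partial>lborel \<partial>lborel)"
    by (subst lborel_pair.Fubini') (simp_all add: k(2))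
  have "2 * ?P = (\<integral>\<^sup>+x. \<integral>\<^sup>+y. 2 * ennreal (a x * a y * k x y) \<partial>lborel \<partial>lborel)"
    by (simp add: nn_integral_cmult)
  also have "\<dots> \<le> (\<integral>\<^sup>+x. \<integral>\<^sup>+y. ennreal ((a x)\<^sup>2) * ennreal (k x y) + ennreal ((a y)\<^sup>2) * ennreal (k x y) \<partial>lborel \<partial>lborel)"
  proof (intro nn_integral_mono)
    fix x y
    have "0 \<le> (a x - a y)\<^sup>2 * k x y" using k(1) by simp
    then have "2 * (a x * a y * k x y) \<le> (a x)\<^sup>2 * k x y + (a y)\<^sup>2 * k x y"
      by (simp add: power2_eq_square algebra_simps)
    then have "ennreal (2 * (a x * a y * k x y)) \<le> ennreal ((a x)\<^sup>2 * k x y + (a y)\<^sup>2 * k x y)"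
      by (rule ennreal_leI)
    then show "2 * ennreal (a x * a y * k x y) \<le> ennreal ((a x)\<^sup>2) * ennreal (k x y) + ennreal ((a y)\<^sup>2) * ennreal (k x y)"
      using k(1)[of x y] by (simp add: ennreal_mult ennreal_plus ennreal_mult')
  qed
  also have "\<dots> = (\<integral>\<^sup>+x. \<integral>\<^sup>+y. ennreal ((a x)\<^sup>2) * ennreal (k x y) \<partial>lborel \<partial>lborel)
    + (\<integral>\<^sup>+x. \<integral>\<^sup>+y. ennreal ((a y)\<^sup>2) * ennreal (k x y) \<partial>lborel \<partial>lborel)"
    by (simp add: nn_integral_add)
  also have "\<dots> \<le> 2 * (\<kappa> * ?E)"
    unfolding B mult_2 by (intro add_mono A)
  finally show ?thesis
    by (simp add: ennreal_mult_le_mult_iff)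
qed

text \<open>Half of Plancherel's theorem. Weight the integral of \<open>|F(f)|^2\<close>, where \<open>F\<close> is the Fourier transform, with a wide Gaussian. The multiplication formula, used twice, turns it into a quadratic form in \<open>f\<close> whose kernel is a narrow Gaussian of total mass \<open>(2 pi)^d\<close>, and Schur's test bounds this form. The weight is removed with Fatou's lemma.\<close>

lemma fourier_integral_energy_le:
  fixes f :: "'a::euclidean_space \<Rightarrow> complex"
  assumes f: "integrable lborel f"
  shows "energy (fourier_integral f) \<le> ennreal ((2 * pi) ^ DIM('a)) * energy f"
proof -
  have [measurable]: "f \<in> borel_measurable borel" using f by auto
  \<comment> \<open>The complex conjugate of the transform of \<open>f\<close> is itself a Fourier transform, namely that of \<open>F\<close>.\<close>
  define F where "F y = cnj (f (- y))" for y
  have [measurable]: "F \<in> borel_measurable borel"  unfolding F_def by measurable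
  have Fint: "integrable lborel F"
    unfolding F_def using integrable_affine_isometry[of "-1" f 0] f by simp
  have FF: "fourier_integral F \<xi> = cnj (fourier_integral f \<xi>)" for \<xi>
  proof -
    have "fourier_integral F \<xi> = cnj (\<integral>y. cis (- (- y \<bullet> \<xi>)) * f (- y) \<partial>lborel)"
      by (simp add: fourier_integral_def F_def cis_cnj flip: Bochner_Integration.integral_cnj)
    also have "(\<integral>y. cis (- (- y \<bullet> \<xi>)) * f (- y) \<partial>lborel) = fourier_integral f \<xi>"
      using integral_affine_isometry[of "-1" "\<lambda>y. cis (- (y \<bullet> \<xi>)) * f y" 0]
      by (simp add: fourier_integral_def)
    finally show ?thesis .
  qed
  have bound: "(\<integral>\<^sup>+\<xi>. ennreal ((norm (fourier_integral f \<xi>))\<^sup>2 * gauss s 0 \<xi>) \<partial>lborel)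
     \<le> ennreal ((2 * pi) ^ DIM('a)) * energy f" if s: "s > 0" for s
  proof -
    define c where "c = sqrt (2 * pi / s) ^ DIM('a)"
    have c: "c \<ge> 0" using s by (simp add: c_def)
    \<comment> \<open>Chosen so that its product with the transform of \<open>f\<close> is the weighted square; the Gaussian makes it integrable.\<close>
    define \<phi> where "\<phi> \<xi> = fourier_integral F \<xi> * complex_of_real (gauss s 0 \<xi>)" for \<xi>
    define N where "N = (\<integral>x. norm (f x) \<partial>lborel)"
    have N: "norm (fourier_integral f \<xi>) \<le> N" for \<xi>
      unfolding N_def by (rule norm_fourier_integral_le)
    have \<phi>int: "integrable lborel \<phi>"
      unfolding \<phi>_def
      by (rule Bochner_Integration.integrable_bound[OF integrable_mult_right[OF gauss_integrable[OF s], of N 0]])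
         (auto simp: norm_mult FF abs_mult intro!: mult_right_mono order_trans[OF N])
    have prod: "fourier_integral f \<xi> * \<phi> \<xi> = complex_of_real ((norm (fourier_integral f \<xi>))\<^sup>2 * gauss s 0 \<xi>)" for \<xi>
      by (simp add: \<phi>_def FF complex_norm_square mult_ac del: of_real_power)
    have int: "integrable lborel (\<lambda>\<xi>. (norm (fourier_integral f \<xi>))\<^sup>2 * gauss s 0 \<xi>)"
      by (rule Bochner_Integration.integrable_bound[OF integrable_mult_right[OF gauss_integrable[OF s], of "N\<^sup>2" 0]])
         (auto simp: abs_mult intro!: mult_right_mono power_mono N)
    have \<phi>hat: "fourier_integral \<phi> x = (\<integral>y. F y * complex_of_real (c * gauss (1 / s) (- x) y) \<partial>lborel)" for x
    proof -
      have "fourier_integral \<phi> x = (\<integral>\<xi>. fourier_integral F \<xi> * (cis (\<xi> \<bullet> (- x)) * complex_of_real (gauss s 0 \<xi>)) \<partial>lborel)"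
        unfolding fourier_integral_def[of \<phi>] \<phi>_def by (simp add: mult_ac)
      also have "\<dots> = (\<integral>y. F y * fourier_integral (\<lambda>\<xi>. cis (\<xi> \<bullet> (- x)) * complex_of_real (gauss s 0 \<xi>)) y \<partial>lborel)"
        by (rule fourier_integral_mult[OF Fint modulated_gauss_integrable[OF s]])
      finally show ?thesis by (simp only: fourier_modulated_gauss[OF s]) (simp add: c_def)
    qed
    have \<phi>bd: "ennreal (norm (fourier_integral \<phi> x)) \<le> (\<integral>\<^sup>+y. ennreal (norm (f y) * (c * gauss (1 / s) x y)) \<partial>lborel)" for x
    proof -
      have "ennreal (norm (fourier_integral \<phi> x)) \<le> (\<integral>\<^sup>+y. ennreal (norm (F y * complex_of_real (c * gauss (1 / s) (- x) y))) \<partial>lborel)"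
        unfolding \<phi>hat
        by (cases "integrable lborel (\<lambda>y. F y * complex_of_real (c * gauss (1 / s) (- x) y))")
           (auto intro: integral_norm_bound_ennreal simp: not_integrable_integral_eq)
      also have "\<dots> = (\<integral>\<^sup>+y. ennreal (norm (f (- y)) * (c * gauss (1 / s) x (- y))) \<partial>lborel)"
        using c by (intro nn_integral_cong) (simp add: norm_mult abs_mult F_def gauss_def norm_minus_commute add.commute)
      also have "\<dots> = (\<integral>\<^sup>+y. ennreal (norm (f y) * (c * gauss (1 / s) x y)) \<partial>lborel)"
        using nn_integral_affine_isometry[of "-1" "\<lambda>y. ennreal (norm (f y) * (c * gauss (1 / s) x y))" 0] by simp
      finally show ?thesis .
    qed
    have "(\<integral>\<^sup>+\<xi>. ennreal ((norm (fourier_integral f \<xi>))\<^sup>2 * gauss s 0 \<xi>) \<partial>lborel)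
      = ennreal (norm (complex_of_real (\<integral>\<xi>. (norm (fourier_integral f \<xi>))\<^sup>2 * gauss s 0 \<xi> \<partial>lborel)))"
      using int by (subst nn_integral_eq_integral) (auto intro!: arg_cong[where f = ennreal] integral_nonneg_AE)
    also have "complex_of_real (\<integral>\<xi>. (norm (fourier_integral f \<xi>))\<^sup>2 * gauss s 0 \<xi> \<partial>lborel)
       = (\<integral>\<xi>. fourier_integral f \<xi> * \<phi> \<xi> \<partial>lborel)"
      unfolding prod by (rule integral_complex_of_real[symmetric])
    also have "\<dots> = (\<integral>x. f x * fourier_integral \<phi> x \<partial>lborel)"
      by (rule fourier_integral_mult[OF f \<phi>int])
    also have "ennreal (norm \<dots>) \<le> (\<integral>\<^sup>+x. ennreal (norm (f x * fourier_integral \<phi> x)) \<partial>lborel)"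
      by (cases "integrable lborel (\<lambda>x. f x * fourier_integral \<phi> x)")
         (auto intro: integral_norm_bound_ennreal simp: not_integrable_integral_eq)
    also have "\<dots> = (\<integral>\<^sup>+x. ennreal (norm (f x)) * ennreal (norm (fourier_integral \<phi> x)) \<partial>lborel)"
      by (simp add: norm_mult ennreal_mult)
    also have "\<dots> \<le> (\<integral>\<^sup>+x. ennreal (norm (f x)) * (\<integral>\<^sup>+y. ennreal (norm (f y) * (c * gauss (1 / s) x y)) \<partial>lborel) \<partial>lborel)"
      by (intro nn_integral_mono mult_left_mono \<phi>bd) auto
    also have "\<dots> = (\<integral>\<^sup>+x. \<integral>\<^sup>+y. ennreal (norm (f x) * norm (f y) * (c * gauss (1 / s) x y)) \<partial>lborel \<partial>lborel)"
    proof (rule nn_integral_cong)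
      fix x
      have "ennreal (norm (f x)) * (\<integral>\<^sup>+y. ennreal (norm (f y) * (c * gauss (1 / s) x y)) \<partial>lborel)
        = (\<integral>\<^sup>+y. ennreal (norm (f x)) * ennreal (norm (f y) * (c * gauss (1 / s) x y)) \<partial>lborel)"
        by (rule nn_integral_cmult[symmetric]) measurable
      then show "ennreal (norm (f x)) * (\<integral>\<^sup>+y. ennreal (norm (f y) * (c * gauss (1 / s) x y)) \<partial>lborel)
        = (\<integral>\<^sup>+y. ennreal (norm (f x) * norm (f y) * (c * gauss (1 / s) x y)) \<partial>lborel)"
        by (simp add: ennreal_mult' mult.assoc)
    qed
    also have "\<dots> \<le> ennreal ((2 * pi) ^ DIM('a)) * (\<integral>\<^sup>+x. ennreal ((norm (f x))\<^sup>2) \<partial>lborel)"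
    proof (rule schur_symmetric)
      show "case_prod (\<lambda>x y. c * gauss (1 / s) x y) \<in> borel_measurable (borel \<Otimes>\<^sub>M borel)"
        unfolding gauss_def by measurable
      show "c * gauss (1 / s) x y \<ge> 0" for x y :: 'a using c by simp
      show "c * gauss (1 / s) x y = c * gauss (1 / s) y x" for x y :: 'a by (simp add: gauss_commute)
      show "(\<integral>\<^sup>+y. ennreal (c * gauss (1 / s) x y) \<partial>lborel) \<le> ennreal ((2 * pi) ^ DIM('a))" for x :: 'a
      proof -
        have "(\<integral>\<^sup>+y. ennreal (c * gauss (1 / s) x y) \<partial>lborel) = ennreal (c * (\<integral>y. gauss (1 / s) x y \<partial>lborel))"
          using s c by (subst nn_integral_eq_integral) (auto intro!: gauss_integrable)
        also have "c * (\<integral>y. gauss (1 / s) x y \<partial>lborel) = (2 * pi) ^ DIM('a)"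
          unfolding c_def gauss_integral[OF divide_pos_pos[OF zero_less_one s]] by (rule gauss_mass_mult[OF s])
        finally show ?thesis by simp
      qed
    qed auto
    finally show ?thesis by (simp add: energy_def)
  qed
  have "energy (fourier_integral f)
     = (\<integral>\<^sup>+\<xi>. liminf (\<lambda>n. ennreal ((norm (fourier_integral f \<xi>))\<^sup>2 * gauss (1 / real (Suc n)) 0 \<xi>)) \<partial>lborel)"
    unfolding energy_def
  proof (rule nn_integral_cong)
    fix \<xi> :: 'a
    have "(\<lambda>n. gauss (1 / real (Suc n)) 0 \<xi>) \<longlonglongrightarrow> exp (- (0 * (norm (\<xi> - 0))\<^sup>2 / 2))"
      unfolding gauss_def by (intro tendsto_intros LIMSEQ_Suc[OF lim_1_over_n]) simp
    then have "(\<lambda>n. ennreal ((norm (fourier_integral f \<xi>))\<^sup>2 * gauss (1 / real (Suc n)) 0 \<xi>))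
        \<longlonglongrightarrow> ennreal ((norm (fourier_integral f \<xi>))\<^sup>2 * exp (- (0 * (norm (\<xi> - 0))\<^sup>2 / 2)))"
      by (intro tendsto_intros)
    from lim_imp_Liminf[OF _ this]
    show "ennreal ((norm (fourier_integral f \<xi>))\<^sup>2) = liminf (\<lambda>n. ennreal ((norm (fourier_integral f \<xi>))\<^sup>2 * gauss (1 / real (Suc n)) 0 \<xi>))"
      by simp
  qed
  also have "\<dots> \<le> liminf (\<lambda>n. \<integral>\<^sup>+\<xi>. ennreal ((norm (fourier_integral f \<xi>))\<^sup>2 * gauss (1 / real (Suc n)) 0 \<xi>) \<partial>lborel)"
    by (rule nn_integral_liminf) measurable
  also have "\<dots> \<le> liminf (\<lambda>n. ennreal ((2 * pi) ^ DIM('a)) * energy f)"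
    by (intro Liminf_mono always_eventually allI bound) simp
  finally show ?thesis by (simp add: Liminf_const)
qed

section \<open>Square integrable functions\<close>

lemma energy_mono_AE:
  "(AE x in lborel. norm (f x) \<le> norm (g x)) \<Longrightarrow> energy f \<le> energy g"
  unfolding energy_def
  by (intro nn_integral_mono_AE) (auto elim!: eventually_mono intro!: ennreal_leI power_mono)

lemma energy_cong_AE: "(AE x in lborel. f x = g x) \<Longrightarrow> energy f = energy g"
  by (intro antisym energy_mono_AE) (auto elim!: eventually_mono)

lemma energy_uminus_commute: "energy (\<lambda>x. f x - g x) = energy (\<lambda>x. g x - f x)"
  by (simp add: energy_def norm_minus_commute)

lemma energy_cmult:
  assumes [measurable]: "f \<in> borel_measurable borel"
  shows "energy (\<lambda>x. c * f x) = ennreal ((norm c)\<^sup>2) * energy f"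
  by (simp add: energy_def norm_mult power_mult_distrib ennreal_mult nn_integral_cmult)

lemma energy_add_le:
  assumes [measurable]: "f \<in> borel_measurable borel" "g \<in> borel_measurable borel"
  shows "energy (\<lambda>x. f x + g x) \<le> 2 * energy f + 2 * energy g"
proof -
  have "energy (\<lambda>x. f x + g x) \<le> (\<integral>\<^sup>+x. 2 * ennreal ((norm (f x))\<^sup>2) + 2 * ennreal ((norm (g x))\<^sup>2) \<partial>lborel)"
    unfolding energy_def
  proof (intro nn_integral_mono)
    fix x
    have "(norm (f x + g x))\<^sup>2 \<le> (norm (f x) + norm (g x))\<^sup>2"
      by (intro power_mono norm_triangle_ineq) simp
    also have "\<dots> \<le> 2 * (norm (f x))\<^sup>2 + 2 * (norm (g x))\<^sup>2"
      using zero_le_power2[of "norm (f x) - norm (g x)"] by (simp add: power2_eq_square algebra_simps)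
    finally have "ennreal ((norm (f x + g x))\<^sup>2) \<le> ennreal (2 * (norm (f x))\<^sup>2 + 2 * (norm (g x))\<^sup>2)"
      by (rule ennreal_leI)
    then show "ennreal ((norm (f x + g x))\<^sup>2) \<le> 2 * ennreal ((norm (f x))\<^sup>2) + 2 * ennreal ((norm (g x))\<^sup>2)"
      by (simp add: ennreal_plus ennreal_mult)
  qed
  also have "\<dots> = 2 * energy f + 2 * energy g"
    by (simp add: energy_def nn_integral_add nn_integral_cmult)
  finally show ?thesis .
qed

lemma energy_diff_le:
  assumes [measurable]: "f \<in> borel_measurable borel" "g \<in> borel_measurable borel" "h \<in> borel_measurable borel"
  shows "energy (\<lambda>x. f x - h x) \<le> 2 * energy (\<lambda>x. f x - g x) + 2 * energy (\<lambda>x. g x - h x)"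
  using energy_add_le[of "\<lambda>x. f x - g x" "\<lambda>x. g x - h x"] by simp

lemma energy_eq_0_iff:
  assumes [measurable]: "f \<in> borel_measurable borel"
  shows "energy f = 0 \<longleftrightarrow> (AE x in lborel. f x = 0)"
  unfolding energy_def by (subst nn_integral_0_iff_AE) auto

lemma energy_finite_diff:
  assumes [measurable]: "f \<in> borel_measurable borel" "g \<in> borel_measurable borel"
    and "energy f < \<infinity>" "energy g < \<infinity>"
  shows "energy (\<lambda>x. f x - g x) < \<infinity>"
proof -
  have "energy (\<lambda>x. f x - g x) \<le> 2 * energy f + 2 * energy g"
    using energy_diff_le[of f "\<lambda>_. 0" g] by (simp add: energy_def)
  also have "\<dots> < \<infinity>" using assms by (simp add: ennreal_mult_less_top)
  finally show ?thesis .
qed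

lemma cauchy_schwarz_energy:
  assumes [measurable]: "f \<in> borel_measurable borel" "g \<in> borel_measurable borel"
  shows "(\<integral>\<^sup>+x. ennreal (norm (f x * g x)) \<partial>lborel)\<^sup>2 \<le> energy f * energy g"
  using Cauchy_Schwarz_nn_integral[of "\<lambda>x. ennreal (norm (f x))" lborel "\<lambda>x. ennreal (norm (g x))"]
  by (simp add: energy_def norm_mult ennreal_mult ennreal_power)

lemma integrable_mult_energy:
  fixes f g :: "'a::euclidean_space \<Rightarrow> complex"
  assumes [measurable]: "f \<in> borel_measurable borel" "g \<in> borel_measurable borel"
    and "energy f < \<infinity>" "energy g < \<infinity>"
  shows "integrable lborel (\<lambda>x. f x * g x)"
proof (rule integrableI_bounded)
  have "(\<integral>\<^sup>+x. ennreal (norm (f x * g x)) \<partial>lborel)\<^sup>2 < \<infinity>"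
    using cauchy_schwarz_energy[of f g] assms(3,4)
    by (simp add: ennreal_mult_less_top order_le_less_trans)
  then show "(\<integral>\<^sup>+x. ennreal (norm (f x * g x)) \<partial>lborel) < \<infinity>"
    by (simp add: power_less_top_ennreal)
qed measurable

text \<open>By the Cauchy-Schwarz inequality the integrals of \<open>(F n - G) g\<close> tend to 0.\<close>

lemma tendsto_integral_mult_energy:
  fixes F :: "nat \<Rightarrow> 'a::euclidean_space \<Rightarrow> complex"
  assumes [measurable]: "\<And>n. F n \<in> borel_measurable borel" "G \<in> borel_measurable borel" "g \<in> borel_measurable borel"
    and fin: "\<And>n. energy (F n) < \<infinity>" "energy G < \<infinity>" "energy g < \<infinity>"
    and lim: "(\<lambda>n. energy (\<lambda>x. F n x - G x)) \<longlonglongrightarrow> 0"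
  shows "(\<lambda>n. \<integral>x. F n x * g x \<partial>lborel) \<longlonglongrightarrow> (\<integral>x. G x * g x \<partial>lborel)"
proof (rule tendsto_L1_int[where F = sequentially])
  show "integrable lborel (\<lambda>x. F n x * g x)" for n
    by (intro integrable_mult_energy fin) auto
  show "integrable lborel (\<lambda>x. G x * g x)"
    by (intro integrable_mult_energy fin) auto
  define a where "a n = (\<integral>\<^sup>+x. ennreal (norm (F n x * g x - G x * g x)) \<partial>lborel)" for n
  have "(\<lambda>n. energy (\<lambda>x. F n x - G x) * energy g) \<longlonglongrightarrow> 0 * energy g"
    using fin(3) by (intro tendsto_mult_ennreal lim tendsto_const) auto
  then have L: "(\<lambda>n. energy (\<lambda>x. F n x - G x) * energy g) \<longlonglongrightarrow> 0" by simp
  have sq: "(a n)\<^sup>2 \<le> energy (\<lambda>x. F n x - G x) * energy g" for n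
    unfolding a_def using cauchy_schwarz_energy[of "\<lambda>x. F n x - G x" g] by (simp add: left_diff_distrib)
  have "a \<longlonglongrightarrow> 0"
  proof (rule order_tendstoI)
    fix c :: ennreal assume "0 < c"
    then have "0 < c\<^sup>2" by (simp add: power2_eq_square ennreal_zero_less_mult_iff)
    with L have "\<forall>\<^sub>F n in sequentially. energy (\<lambda>x. F n x - G x) * energy g < c\<^sup>2"
      by (rule order_tendstoD)
    then show "\<forall>\<^sub>F n in sequentially. a n < c"
      by eventually_elim (metis sq le_less_trans not_less power_mono zero_le)
  qed auto
  then show "(\<lambda>n. \<integral>\<^sup>+x. ennreal (norm (F n x * g x - G x * g x)) \<partial>lborel) \<longlonglongrightarrow> 0"
    unfolding a_def .
qed

lemma energy_limit_unique:
  assumes [measurable]: "\<And>n. F n \<in> borel_measurable borel" "G \<in> borel_measurable borel" "H \<in> borel_measurable borel"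
    and G: "(\<lambda>n. energy (\<lambda>x. F n x - G x)) \<longlonglongrightarrow> 0" and H: "(\<lambda>n. energy (\<lambda>x. F n x - H x)) \<longlonglongrightarrow> 0"
  shows "AE x in lborel. G x = H x"
proof -
  have "(\<lambda>n. 2 * energy (\<lambda>x. F n x - G x) + 2 * energy (\<lambda>x. F n x - H x)) \<longlonglongrightarrow> 2 * 0 + 2 * 0"
    by (intro tendsto_add tendsto_mult_ennreal tendsto_const G H) auto
  moreover have "energy (\<lambda>x. G x - H x) \<le> 2 * energy (\<lambda>x. F n x - G x) + 2 * energy (\<lambda>x. F n x - H x)" for n
    using energy_diff_le[of G "F n" H] by (simp add: energy_uminus_commute[of G])
  ultimately have "energy (\<lambda>x. G x - H x) \<le> 2 * 0 + 2 * 0"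
    by (intro tendsto_lowerbound) auto
  then have "energy (\<lambda>x. G x - H x) = 0" by simp
  then show ?thesis by (subst (asm) energy_eq_0_iff) auto
qed

text \<open>The argument of Riesz and Fischer. Along a sufficiently sparse subsequence the increments are square summable with the weights \<open>4^k\<close>, hence almost everywhere at most a constant times \<open>2^(-k)\<close>. So the subsequence converges almost everywhere, and Fatou's lemma turns this into convergence in mean of the whole sequence.\<close>

lemma energy_complete:
  fixes F :: "nat \<Rightarrow> 'a::euclidean_space \<Rightarrow> complex"
  assumes [measurable]: "\<And>n. F n \<in> borel_measurable borel"
    and fin: "\<And>n. energy (F n) < \<infinity>"
    and cauchy: "\<And>e. e > 0 \<Longrightarrow> \<exists>N. \<forall>m\<ge>N. \<forall>n\<ge>N. energy (\<lambda>x. F m x - F n x) \<le> ennreal e"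
  obtains G where "G \<in> borel_measurable borel" "energy G < \<infinity>" "(\<lambda>n. energy (\<lambda>x. F n x - G x)) \<longlonglongrightarrow> 0"
proof -
  have "\<exists>N. \<forall>m\<ge>N. \<forall>n\<ge>N. energy (\<lambda>x. F m x - F n x) \<le> ennreal ((1/8)^k)" for k
    by (rule cauchy) simp
  then obtain N where N: "\<And>k m n. m \<ge> N k \<Longrightarrow> n \<ge> N k \<Longrightarrow> energy (\<lambda>x. F m x - F n x) \<le> ennreal ((1/8)^k)"
    by metis
  \<comment> \<open>Partial sums, in order to dominate all earlier thresholds at once.\<close>
  define \<nu> where "\<nu> k = (\<Sum>j\<le>k. N j)" for k
  have \<nu>: "N j \<le> \<nu> k" if "j \<le> k" for j k
    unfolding \<nu>_def using that by (intro member_le_sum) auto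
  define D where "D k x = F (\<nu> (Suc k)) x - F (\<nu> k) x" for k x
  have [measurable]: "D k \<in> borel_measurable borel" for k unfolding D_def by measurable
  have D: "energy (D k) \<le> ennreal ((1/8)^k)" for k
    unfolding D_def by (intro N \<nu>) auto
  define S where "S x = (\<Sum>k. ennreal (4^k * (norm (D k x))\<^sup>2))" for x
  have "(\<integral>\<^sup>+x. S x \<partial>lborel) = (\<Sum>k. \<integral>\<^sup>+x. ennreal (4^k * (norm (D k x))\<^sup>2) \<partial>lborel)"
    unfolding S_def by (rule nn_integral_suminf) measurable
  also have "\<dots> = (\<Sum>k. ennreal (4^k) * energy (D k))"
    by (simp add: energy_def ennreal_mult' nn_integral_cmult)
  also have "\<dots> \<le> (\<Sum>k. ennreal ((1/2)^k))"
  proof (rule suminf_le)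
    fix k
    have "ennreal (4^k) * energy (D k) \<le> ennreal (4^k) * ennreal ((1/8)^k)"
      by (intro mult_left_mono D) simp
    also have "\<dots> = ennreal ((1/2)^k)"
      by (subst ennreal_mult[symmetric]) (auto simp flip: power_mult_distrib)
    finally show "ennreal (4^k) * energy (D k) \<le> ennreal ((1/2)^k)" .
  qed auto
  also have "\<dots> = ennreal (\<Sum>k. (1/2)^k)"
    by (rule suminf_ennreal2) (auto intro: summable_geometric)
  finally have "(\<integral>\<^sup>+x. S x \<partial>lborel) \<noteq> \<infinity>"
    using ennreal_less_top not_le top.not_eq_extremum by (metis infinity_ennreal_def)
  then have S: "AE x in lborel. S x \<noteq> \<infinity>"
    unfolding S_def by (intro nn_integral_PInf_AE) measurable
  have conv: "convergent (\<lambda>k. F (\<nu> k) x)" if "S x \<noteq> \<infinity>" for x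
  proof -
    from that have "S x < \<infinity>" by (simp add: less_top)
    then obtain s where s: "S x = ennreal s" "s \<ge> 0"
      by (cases "S x") auto
    have "norm (D k x) \<le> sqrt s * (1/2)^k" for k
    proof -
      have "ennreal (4^k * (norm (D k x))\<^sup>2) = (\<Sum>i\<in>{k}. ennreal (4^i * (norm (D i x))\<^sup>2))" by simp
      also have "\<dots> \<le> S x" unfolding S_def by (intro sum_le_suminf) auto
      finally have "4^k * (norm (D k x))\<^sup>2 \<le> s" using s by simp
      moreover have "4^k * (norm (D k x))\<^sup>2 = (2^k * norm (D k x))\<^sup>2"
      proof -
        have "(4::real)^k = (2^k)\<^sup>2" by (simp add: power2_eq_square flip: power_mult_distrib)
        then show ?thesis by (simp only: power_mult_distrib)
      qed
      ultimately have "2^k * norm (D k x) \<le> sqrt s"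
        by (intro real_le_rsqrt) simp
      then show ?thesis by (simp add: field_simps power_one_over)
    qed
    moreover have "summable (\<lambda>k. sqrt s * (1/2)^k)"
      by (intro summable_mult summable_geometric) simp
    ultimately have "summable (\<lambda>k. D k x)"
      by (metis (no_types, lifting) summable_comparison_test)
    moreover have "(\<Sum>k<n. D k x) = F (\<nu> n) x - F (\<nu> 0) x" for n
      unfolding D_def by (rule sum_lessThan_telescope)
    ultimately have "convergent (\<lambda>n. F (\<nu> n) x - F (\<nu> 0) x)"
      by (simp add: summable_iff_convergent)
    from convergent_add[OF this convergent_const[of "F (\<nu> 0) x"]] show ?thesis by simp
  qed
  define G where "G x = lim (\<lambda>k. F (\<nu> k) x)" for x
  have [measurable]: "G \<in> borel_measurable borel"
    unfolding G_def by measurable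
  have close: "energy (\<lambda>x. F m x - G x) \<le> ennreal ((1/8)^j)" if m: "m \<ge> N j" for m j
  proof -
    have "energy (\<lambda>x. F m x - G x) \<le> (\<integral>\<^sup>+x. liminf (\<lambda>k. ennreal ((norm (F m x - F (\<nu> k) x))\<^sup>2)) \<partial>lborel)"
      unfolding energy_def
    proof (rule nn_integral_mono_AE, use S in eventually_elim)
      fix x assume "S x \<noteq> \<infinity>"
      then have "(\<lambda>k. F (\<nu> k) x) \<longlonglongrightarrow> G x"
        using conv unfolding G_def convergent_LIMSEQ_iff by blast
      then have "(\<lambda>k. ennreal ((norm (F m x - F (\<nu> k) x))\<^sup>2)) \<longlonglongrightarrow> ennreal ((norm (F m x - G x))\<^sup>2)"
        by (intro tendsto_intros)
      from lim_imp_Liminf[OF _ this]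
      show "ennreal ((norm (F m x - G x))\<^sup>2) \<le> liminf (\<lambda>k. ennreal ((norm (F m x - F (\<nu> k) x))\<^sup>2))" by simp
    qed
    also have "\<dots> \<le> liminf (\<lambda>k. energy (\<lambda>x. F m x - F (\<nu> k) x))"
      unfolding energy_def by (rule nn_integral_liminf) measurable
    also have "\<dots> \<le> liminf (\<lambda>k. ennreal ((1/8)^j))"
      by (rule Liminf_mono) (use eventually_ge_at_top[of j] in eventually_elim, intro N m \<nu>)
    finally show ?thesis by (simp add: Liminf_const)
  qed
  have "(\<lambda>j. (1/8::real)^j) \<longlonglongrightarrow> 0" by (rule LIMSEQ_power_zero) simp
  then have 8: "(\<lambda>j. ennreal ((1/8)^j)) \<longlonglongrightarrow> ennreal 0" by (rule tendsto_ennrealI)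
  have lim: "(\<lambda>n. energy (\<lambda>x. F n x - G x)) \<longlonglongrightarrow> 0"
  proof (rule order_tendstoI)
    fix c :: ennreal assume "0 < c"
    then have "\<forall>\<^sub>F j in sequentially. ennreal ((1/8)^j) < c"
      using 8 by (intro order_tendstoD) auto
    then obtain j where j: "ennreal ((1/8)^j) < c" by (auto simp: eventually_sequentially)
    show "\<forall>\<^sub>F n in sequentially. energy (\<lambda>x. F n x - G x) < c"
      using eventually_ge_at_top[of "N j"] by eventually_elim (use close j in \<open>blast intro: le_less_trans\<close>)
  qed auto
  have "energy (\<lambda>x. F (N 0) x - (F (N 0) x - G x)) < \<infinity>"
  proof (rule energy_finite_diff[of "F (N 0)" "\<lambda>x. F (N 0) x - G x"])
    show "energy (\<lambda>x. F (N 0) x - G x) < \<infinity>"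
      using close[of 0 "N 0"] by (auto intro: le_less_trans)
  qed (use fin in auto)
  then have "energy G < \<infinity>" by simp
  with lim show thesis by (intro that) auto
qed

section \<open>The Fourier transform on square integrable functions\<close>

text \<open>Translates the norm, which is a real power of an extended integral, into an integral of squares.\<close>

lemma L2_norm_power2: "(L2_norm f)\<^sup>2 = energy f"
proof -
  have "ennpowr (ennreal (norm (f x))) (enn2real 2) = ennreal ((norm (f x))\<^sup>2)" for x
    by (simp add: ennpowr_def powr_numeral)
  then have L: "L2_norm f = ennpowr (energy f) (1 / 2)"
    by (simp add: L2_norm_def Lp_norm_def energy_def)
  show ?thesis
  proof (cases "energy f")
    case (real r)
    then show ?thesis
      unfolding L by (simp add: ennpowr_def powr_half_sqrt ennreal_power)
  next
    case top
    then show ?thesis unfolding L by (simp add: ennpowr_def power2_eq_square)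
  qed
qed

lemma L2_fun_iff: "L2_fun f \<longleftrightarrow> f \<in> borel_measurable borel \<and> energy f < \<infinity>"
  by (simp add: L2_fun_def power_less_top_ennreal flip: L2_norm_power2)

lemma L2_norm_tendsto_0_iff:
  "((\<lambda>n. L2_norm (F n)) \<longlonglongrightarrow> 0) \<longleftrightarrow> ((\<lambda>n. energy (F n)) \<longlonglongrightarrow> 0)"
proof
  assume L: "(\<lambda>n. L2_norm (F n)) \<longlonglongrightarrow> 0"
  have "(\<lambda>n. L2_norm (F n) * L2_norm (F n)) \<longlonglongrightarrow> 0 * 0"
    by (intro tendsto_mult_ennreal L) auto
  then show "(\<lambda>n. energy (F n)) \<longlonglongrightarrow> 0" by (simp flip: L2_norm_power2 add: power2_eq_square)
next
  assume L: "(\<lambda>n. energy (F n)) \<longlonglongrightarrow> 0"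
  show "(\<lambda>n. L2_norm (F n)) \<longlonglongrightarrow> 0"
  proof (rule order_tendstoI)
    fix c :: ennreal assume "0 < c"
    then have "0 < c\<^sup>2" by (simp add: power2_eq_square ennreal_zero_less_mult_iff)
    with L have "\<forall>\<^sub>F n in sequentially. energy (F n) < c\<^sup>2"
      by (rule order_tendstoD)
    then show "\<forall>\<^sub>F n in sequentially. L2_norm (F n) < c"
      by eventually_elim (metis L2_norm_power2 not_less power_mono zero_le)
  qed auto
qed

text \<open>The cut-off by balls through which the Fourier transform on \<open>L^2\<close> is defined; it makes a square integrable function integrable.\<close>

definition truncate :: "('a::euclidean_space \<Rightarrow> complex) \<Rightarrow> nat \<Rightarrow> 'a \<Rightarrow> complex" where
  "truncate f n x = indicator (cball 0 (real n)) x * f x"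

lemma truncate_measurable [measurable]:
  "f \<in> borel_measurable borel \<Longrightarrow> truncate f n \<in> borel_measurable borel"
  unfolding truncate_def by (intro borel_measurable_times borel_measurable_indicator) auto

lemma is_L2_fourier_iff:
  "is_L2_fourier f G \<longleftrightarrow> L2_fun G \<and>
    (\<lambda>n. energy (\<lambda>\<xi>. fourier_integral (truncate f n) \<xi> - G \<xi>)) \<longlonglongrightarrow> 0"
  unfolding is_L2_fourier_def L2_norm_tendsto_0_iff truncate_def ..

lemma energy_truncate_le: "energy (truncate f n) \<le> energy f"
  by (intro energy_mono_AE) (auto simp: truncate_def indicator_def)

lemma integrable_truncate:
  fixes f :: "'a::euclidean_space \<Rightarrow> complex"
  assumes [measurable]: "f \<in> borel_measurable borel" and f: "energy f < \<infinity>"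
  shows "integrable lborel (truncate f n)"
  unfolding truncate_def
proof (rule integrable_mult_energy[OF _ _ _ f])
  have "energy (indicator (cball (0::'a) (real n))) = emeasure lborel (cball (0::'a) (real n))"
  proof -
    have "energy (indicator (cball (0::'a) (real n))) = (\<integral>\<^sup>+x. indicator (cball (0::'a) (real n)) x \<partial>lborel)"
      unfolding energy_def by (intro nn_integral_cong) (auto simp: indicator_def)
    then show ?thesis by simp
  qed
  also have "\<dots> < \<infinity>"
    by (rule emeasure_bounded_finite) simp
  finally show "energy (indicator (cball (0::'a) (real n))) < \<infinity>" .
qed (auto intro!: borel_measurable_indicator)

lemma truncate_tendsto:
  fixes f :: "'a::euclidean_space \<Rightarrow> complex"
  assumes [measurable]: "f \<in> borel_measurable borel" and f: "energy f < \<infinity>"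
  shows "(\<lambda>n. energy (\<lambda>x. truncate f n x - f x)) \<longlonglongrightarrow> 0"
proof -
  have "(\<lambda>n. energy (\<lambda>x. truncate f n x - f x)) \<longlonglongrightarrow> (\<integral>\<^sup>+x. 0 \<partial>(lborel :: 'a measure))"
    unfolding energy_def
  proof (rule nn_integral_dominated_convergence[where w = "\<lambda>x. ennreal ((norm (f x))\<^sup>2)"])
    show "(\<integral>\<^sup>+x. ennreal ((norm (f x))\<^sup>2) \<partial>lborel) < \<infinity>"
      using f by (simp add: energy_def)
    show "AE x in lborel. (\<lambda>n. ennreal ((norm (truncate f n x - f x))\<^sup>2)) \<longlonglongrightarrow> 0"
    proof (rule AE_I2)
      fix x :: 'a
      obtain N :: nat where N: "norm x \<le> real N" using real_arch_simple by blast
      have "\<forall>\<^sub>F n in sequentially. ennreal ((norm (truncate f n x - f x))\<^sup>2) = 0"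
        using eventually_ge_at_top[of N] by eventually_elim (use N in \<open>auto simp: truncate_def indicator_def\<close>)
      then show "(\<lambda>n. ennreal ((norm (truncate f n x - f x))\<^sup>2)) \<longlonglongrightarrow> 0"
        by (rule tendsto_eventually)
    qed
  qed (auto simp: truncate_def indicator_def)
  then show ?thesis by simp
qed

lemma fourier_integral_diff:
  fixes f g :: "'a::euclidean_space \<Rightarrow> complex"
  assumes "integrable lborel f" "integrable lborel g"
  shows "fourier_integral (\<lambda>x. f x - g x) \<xi> = fourier_integral f \<xi> - fourier_integral g \<xi>"
  unfolding fourier_integral_def right_diff_distrib
  by (intro Bochner_Integration.integral_diff integrable_cis_mult assms) auto

text \<open>The truncations form a Cauchy sequence in mean, and \<open>fourier_integral_energy_le\<close> passes this on to their Fourier integrals.\<close>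

lemma is_L2_fourier_exists:
  fixes f :: "'a::euclidean_space \<Rightarrow> complex"
  assumes "L2_fun f"
  shows "\<exists>G. is_L2_fourier f G"
proof -
  have [measurable]: "f \<in> borel_measurable borel" and f: "energy f < \<infinity>"
    using assms by (auto simp: L2_fun_iff)
  let ?P = "ennreal ((2 * pi) ^ DIM('a))"
  note int = integrable_truncate[OF _ f]
  have le: "energy (\<lambda>\<xi>. fourier_integral (truncate f m) \<xi> - fourier_integral (truncate f n) \<xi>)
    \<le> ?P * (2 * energy (\<lambda>x. truncate f m x - f x) + 2 * energy (\<lambda>x. truncate f n x - f x))" for m n
  proof -
    have "energy (\<lambda>\<xi>. fourier_integral (truncate f m) \<xi> - fourier_integral (truncate f n) \<xi>)
      = energy (fourier_integral (\<lambda>x. truncate f m x - truncate f n x))"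
      by (rule arg_cong[where f = energy], rule ext, rule fourier_integral_diff[symmetric]) (auto intro: int)
    also have "\<dots> \<le> ?P * energy (\<lambda>x. truncate f m x - truncate f n x)"
      by (intro fourier_integral_energy_le Bochner_Integration.integrable_diff int) auto
    also have "\<dots> \<le> ?P * (2 * energy (\<lambda>x. truncate f m x - f x) + 2 * energy (\<lambda>x. truncate f n x - f x))"
      using energy_diff_le[of "truncate f m" f "truncate f n"]
      by (intro mult_left_mono) (auto simp: energy_uminus_commute[of f])
    finally show ?thesis .
  qed
  obtain G where "G \<in> borel_measurable borel" "energy G < \<infinity>"
    "(\<lambda>n. energy (\<lambda>\<xi>. fourier_integral (truncate f n) \<xi> - G \<xi>)) \<longlonglongrightarrow> 0"
  proof (rule energy_complete)
    show "fourier_integral (truncate f n) \<in> borel_measurable borel" for n by measurable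
    show "energy (fourier_integral (truncate f n)) < \<infinity>" for n
    proof -
      have "energy (fourier_integral (truncate f n)) \<le> ?P * energy f"
        by (rule order_trans[OF fourier_integral_energy_le]) (auto intro: int mult_left_mono energy_truncate_le)
      also have "\<dots> < \<infinity>" using f by (simp add: ennreal_mult_less_top)
      finally show ?thesis .
    qed
    fix e :: real assume e: "e > 0"
    have "(\<lambda>n. ?P * (4 * energy (\<lambda>x. truncate f n x - f x))) \<longlonglongrightarrow> ?P * (4 * 0)"
      by (intro tendsto_mult_ennreal tendsto_const truncate_tendsto f) auto
    then have "\<forall>\<^sub>F n in sequentially. ?P * (4 * energy (\<lambda>x. truncate f n x - f x)) < ennreal e"
      using e by (intro order_tendstoD(2)[of _ "?P * (4 * 0)"]) auto
    then obtain N where N: "\<And>n. n \<ge> N \<Longrightarrow> ?P * (4 * energy (\<lambda>x. truncate f n x - f x)) < ennreal e"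
      unfolding eventually_sequentially by blast
    have "energy (\<lambda>\<xi>. fourier_integral (truncate f m) \<xi> - fourier_integral (truncate f n) \<xi>) \<le> ennreal e"
      if "m \<ge> N" "n \<ge> N" for m n
    proof -
      let ?d = "\<lambda>n. energy (\<lambda>x. truncate f n x - f x)"
      obtain k where k: "k \<in> {m, n}" "?d m \<le> ?d k" "?d n \<le> ?d k"
        using linear[of "?d m" "?d n"] by blast
      have "?P * (2 * ?d m + 2 * ?d n) \<le> ?P * (2 * ?d k + 2 * ?d k)"
        using k by (intro mult_left_mono add_mono) auto
      also have "2 * ?d k + 2 * ?d k = 4 * ?d k"
        by (simp flip: distrib_right)
      also have "?P * (4 * ?d k) \<le> ennreal e"
        using N[of k] k(1) that by auto
      finally show ?thesis using le[of m n] by (rule order_trans[rotated])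
    qed
    then show "\<exists>N. \<forall>m\<ge>N. \<forall>n\<ge>N. energy (\<lambda>\<xi>. fourier_integral (truncate f m) \<xi> - fourier_integral (truncate f n) \<xi>) \<le> ennreal e"
      by blast
  qed
  then show ?thesis by (auto simp: is_L2_fourier_iff L2_fun_iff)
qed

lemma L2_fourier_is: "L2_fun f \<Longrightarrow> is_L2_fourier f (L2_fourier f)"
  unfolding L2_fourier_def using someI_ex[OF is_L2_fourier_exists] .

lemma is_L2_fourier_unique:
  assumes f: "L2_fun f" and "is_L2_fourier f G" "is_L2_fourier f H"
  shows "AE \<xi> in lborel. G \<xi> = H \<xi>"
  using assms by (intro energy_limit_unique[of "\<lambda>n. fourier_integral (truncate f n)"])
    (auto simp: is_L2_fourier_iff L2_fun_iff)

text \<open>The multiplication formula holds for the truncations of \<open>h\<close>, and both of its sides are continuous in mean.\<close>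

lemma is_L2_fourier_mult:
  fixes h :: "'a::euclidean_space \<Rightarrow> complex"
  assumes h: "L2_fun h" and G: "is_L2_fourier h G" and g: "integrable lborel g" "energy g < \<infinity>"
  shows "(\<integral>\<xi>. G \<xi> * g \<xi> \<partial>lborel) = (\<integral>x. h x * fourier_integral g x \<partial>lborel)"
proof (rule LIMSEQ_unique)
  have [measurable]: "h \<in> borel_measurable borel" "G \<in> borel_measurable borel" "g \<in> borel_measurable borel"
    using h G g by (auto simp: L2_fun_iff is_L2_fourier_iff)
  have fin: "energy h < \<infinity>" "energy G < \<infinity>"
    using h G by (auto simp: L2_fun_iff is_L2_fourier_iff)
  let ?P = "ennreal ((2 * pi) ^ DIM('a))"
  have F: "energy (fourier_integral k) < \<infinity>" if "integrable lborel k" "energy k < \<infinity>" for k :: "'a \<Rightarrow> complex"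
    using that by (intro le_less_trans[OF fourier_integral_energy_le]) (auto simp: ennreal_mult_less_top)
  have T: "energy (truncate h n) < \<infinity>" for n
    by (rule le_less_trans[OF energy_truncate_le fin(1)])
  note int = integrable_truncate[OF _ fin(1)]
  show "(\<lambda>n. \<integral>\<xi>. fourier_integral (truncate h n) \<xi> * g \<xi> \<partial>lborel) \<longlonglongrightarrow> (\<integral>\<xi>. G \<xi> * g \<xi> \<partial>lborel)"
    using G by (intro tendsto_integral_mult_energy fin g F T int) (auto simp: is_L2_fourier_iff)
  have "(\<lambda>n. \<integral>x. truncate h n x * fourier_integral g x \<partial>lborel) \<longlonglongrightarrow> (\<integral>x. h x * fourier_integral g x \<partial>lborel)"
    by (intro tendsto_integral_mult_energy fin g F T truncate_tendsto) auto
  then show "(\<lambda>n. \<integral>\<xi>. fourier_integral (truncate h n) \<xi> * g \<xi> \<partial>lborel) \<longlonglongrightarrow> (\<integral>x. h x * fourier_integral g x \<partial>lborel)"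
    by (simp add: fourier_integral_mult[OF int g(1)])
qed

section \<open>Functions orthogonal to all Gaussians\<close>

text \<open>The positive and the negative part of \<open>k\<close> are densities of two finite measures. These agree on boxes, which generate the Borel sets and are closed under intersection.\<close>

lemma AE_zero_if_box_integrals_zero:
  fixes k :: "'a::euclidean_space \<Rightarrow> real"
  assumes k: "integrable lborel k" and box: "\<And>l u. (\<integral>x. k x * indicator (box l u) x \<partial>lborel) = 0"
  shows "AE x in lborel. k x = 0"
proof -
  have [measurable]: "k \<in> borel_measurable borel" using k by auto
  let ?\<mu> = "density lborel (\<lambda>x. ennreal (k x))" and ?\<nu> = "density lborel (\<lambda>x. ennreal (- k x))"
  have fin: "(\<integral>\<^sup>+x. ennreal (k x) \<partial>lborel) < \<infinity>" "(\<integral>\<^sup>+x. ennreal (- k x) \<partial>lborel) < \<infinity>"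
    using k by (auto simp: real_integrable_def less_top)
  have dens: "emeasure (density lborel (\<lambda>x. ennreal (j x))) (box l u)
      = (\<integral>\<^sup>+x. ennreal (j x * indicator (box l u) x) \<partial>lborel)"
    if [measurable]: "j \<in> borel_measurable borel" for j :: "'a \<Rightarrow> real" and l u
    by (subst emeasure_density) (auto intro!: nn_integral_cong simp: indicator_def)
  have "?\<mu> = ?\<nu>"
  proof (rule measure_eqI_generator_eq)
    let ?E = "range (\<lambda>(a, b). box a b::'a set)"
    show "Int_stable ?E"
      by (auto simp: Int_stable_def box_Int_box)
    show "?E \<subseteq> Pow UNIV" "sets ?\<mu> = sigma_sets UNIV ?E" "sets ?\<nu> = sigma_sets UNIV ?E"
      by (simp_all add: borel_eq_box)
    let ?A = "\<lambda>n::nat. box (- (real n *\<^sub>R One)) (real n *\<^sub>R One) :: 'a set"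
    show "range ?A \<subseteq> ?E" "(\<Union>i. ?A i) = UNIV"
      unfolding UN_box_eq_UNIV by auto
    show "emeasure ?\<mu> (?A i) \<noteq> \<infinity>" for i
    proof -
      have "emeasure ?\<mu> (?A i) \<le> (\<integral>\<^sup>+x. ennreal (k x) \<partial>lborel)"
        unfolding dens[OF \<open>k \<in> _\<close>] by (intro nn_integral_mono) (auto simp: indicator_def)
      with fin show ?thesis by (auto simp: top_unique)
    qed
    fix X assume "X \<in> ?E"
    then obtain l u where X: "X = box l u" by auto
    let ?h = "\<lambda>x. k x * indicator (box l u) x"
    have "integrable lborel ?h"
      by (rule Bochner_Integration.integrable_bound[OF k]) (auto simp: indicator_def)
    then have f: "(\<integral>\<^sup>+x. ennreal (?h x) \<partial>lborel) < \<infinity>" "(\<integral>\<^sup>+x. ennreal (- ?h x) \<partial>lborel) < \<infinity>"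
      and "(\<integral>x. ?h x \<partial>lborel) = enn2real (\<integral>\<^sup>+x. ennreal (?h x) \<partial>lborel) - enn2real (\<integral>\<^sup>+x. ennreal (- ?h x) \<partial>lborel)"
      by (auto simp: real_integrable_def less_top real_lebesgue_integral_def)
    with box have "enn2real (\<integral>\<^sup>+x. ennreal (?h x) \<partial>lborel) = enn2real (\<integral>\<^sup>+x. ennreal (- ?h x) \<partial>lborel)"
      by simp
    then have "(\<integral>\<^sup>+x. ennreal (?h x) \<partial>lborel) = (\<integral>\<^sup>+x. ennreal (- ?h x) \<partial>lborel)"
      using f by (metis ennreal_enn2real infinity_ennreal_def)
    then show "emeasure ?\<mu> X = emeasure ?\<nu> X"
      unfolding X by (subst (1 2) dens) auto
  qed
  then have "AE x in lborel. ennreal (k x) = ennreal (- k x)"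
    using fin by (subst (asm) finite_density_unique) auto
  then show ?thesis
    by eventually_elim (metis ennreal_eq_0_iff ennreal_neg linear neg_le_0_iff_le order_antisym)
qed

lemma AE_not_in_box_boundary: "AE x in lborel. x \<notin> cbox l u - box l (u::'a::euclidean_space)"
proof (rule AE_not_in, rule null_setsI)
  show "emeasure lborel (cbox l u - box l u) = 0"
    by (subst emeasure_Diff)
       (auto simp: box_subset_cbox emeasure_lborel_box_eq emeasure_lborel_cbox_eq)
qed auto

lemma gauss_le_integrable:
  fixes \<phi> :: "'a::euclidean_space \<Rightarrow> complex"
  assumes "s > 0" and [measurable]: "\<phi> \<in> borel_measurable borel" and "\<And>x. norm (\<phi> x) \<le> 1"
  shows "integrable lborel (\<lambda>x. \<phi> x * complex_of_real (gauss s a x))"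
  by (rule Bochner_Integration.integrable_bound[OF gauss_integrable[OF assms(1), of a]])
     (auto simp: norm_mult assms intro!: mult_left_le_one_le)

lemma gauss_le_norm_integrable:
  fixes \<phi> :: "'a::euclidean_space \<Rightarrow> complex"
  assumes "s > 0" and "\<phi> \<in> borel_measurable borel" and "\<And>x. norm (\<phi> x) \<le> 1"
  shows "integrable lborel (\<lambda>x. norm (\<phi> x) * gauss s a x)"
  using integrable_norm[OF gauss_le_integrable[OF assms, of a]] by (simp add: norm_mult)

text \<open>Averaging the hypothesis over the centres \<open>a\<close> in a box shows that \<open>K\<close> integrates to 0 against the convolution of the indicator of the box with a Gaussian. As the Gaussian narrows, this convolution tends, off the boundary, to a multiple of the indicator, so \<open>K\<close> integrates to 0 over every box.\<close>

lemma AE_zero_if_gauss_integrals_zero_L1: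
  fixes K :: "'a::euclidean_space \<Rightarrow> complex"
  assumes K: "integrable lborel K"
    and zero: "\<And>s a. s > 0 \<Longrightarrow> (\<integral>x. K x * complex_of_real (gauss s a x) \<partial>lborel) = 0"
  shows "AE x in lborel. K x = 0"
proof -
  have [measurable]: "K \<in> borel_measurable borel" using K by auto
  define c where "c = (\<integral>z. gauss 1 0 (z :: 'a) \<partial>lborel)"
  have c: "c > 0" unfolding c_def by (simp add: gauss_integral)
  have "(\<integral>x. K x * indicator (box l u) x \<partial>lborel) = 0" for l u
  proof -
    let ?S = "box l u"
    let ?I = "\<lambda>x. indicator ?S x :: complex"
    have Im: "?I \<in> borel_measurable borel" by (intro borel_measurable_indicator) auto
    note [measurable] = Im
    have I1: "norm (?I x) \<le> 1" for x by (simp add: indicator_def)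
    \<comment> \<open>The convolution of the indicator with the Gaussian, rescaled so that the Gaussian is fixed and the box is what varies: this allows dominated convergence.\<close>
    define \<psi> where "\<psi> s x = (\<integral>z. ?I (x + (1 / sqrt s) *\<^sub>R z) * complex_of_real (gauss 1 0 z) \<partial>lborel)" for s x
    have \<psi>m [measurable]: "\<psi> s \<in> borel_measurable borel" for s
      unfolding \<psi>_def gauss_def by measurable
    have \<psi>_le: "norm (\<psi> s x) \<le> c" for s x
      unfolding \<psi>_def c_def
      by (rule order_trans[OF integral_norm_bound], rule integral_mono)
         (auto intro!: gauss_le_integrable gauss_le_norm_integrable gauss_integrable mult_left_le_one_le I1 simp: norm_mult)
    have conv0: "(\<integral>x. K x * \<psi> s x \<partial>lborel) = 0" if s: "s > 0" for s
    proof -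
      define \<delta> where "\<delta> = 1 / sqrt s"
      have \<delta>: "\<delta> > 0" "s * \<delta>\<^sup>2 = 1" using s by (auto simp: \<delta>_def power_divide)
      have sub: "(\<integral>a. ?I a * complex_of_real (gauss s x a) \<partial>lborel) = complex_of_real (\<delta> ^ DIM('a)) * \<psi> s x" for x
      proof -
        have "gauss s x (x + \<delta> *\<^sub>R z) = gauss 1 0 z" for z
          using \<delta> by (simp add: gauss_def power_mult_distrib mult.assoc[symmetric])
        then show ?thesis
          using \<delta> unfolding \<psi>_def \<delta>_def[symmetric]
          by (subst lborel_affine[of \<delta> x])
             (auto simp: integral_density integral_distr scaleR_conv_of_real)
      qed
      have "integrable (lborel \<Otimes>\<^sub>M lborel) (case_prod (\<lambda>x a. K x * (?I a * complex_of_real (gauss s x a))))"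
      proof (rule lborel_pair.Fubini_integrable)
        show "case_prod (\<lambda>x a. K x * (?I a * complex_of_real (gauss s x a))) \<in> borel_measurable (lborel \<Otimes>\<^sub>M lborel)"
          unfolding gauss_def by measurable
        have "integrable lborel (\<lambda>x. norm (K x) * (\<integral>a. norm (?I a * complex_of_real (gauss s x a)) \<partial>lborel))"
        proof (rule Bochner_Integration.integrable_bound)
          show "integrable lborel (\<lambda>x. norm (K x) * sqrt (2 * pi / s) ^ DIM('a))" using K by simp
          show "(\<lambda>x. norm (K x) * (\<integral>a. norm (?I a * complex_of_real (gauss s x a)) \<partial>lborel)) \<in> borel_measurable lborel"
            unfolding gauss_def by measurable
          have "(\<integral>a. norm (?I a * complex_of_real (gauss s x a)) \<partial>lborel) \<le> sqrt (2 * pi / s) ^ DIM('a)" for x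
            unfolding gauss_integral[OF s, symmetric, of x]
            by (rule integral_mono)
               (auto intro!: gauss_le_integrable gauss_le_norm_integrable gauss_integrable mult_left_le_one_le I1 s simp: norm_mult)
          then show "AE x in lborel. norm (norm (K x) * (\<integral>a. norm (?I a * complex_of_real (gauss s x a)) \<partial>lborel))
             \<le> norm (norm (K x) * sqrt (2 * pi / s) ^ DIM('a))"
            using s by (intro AE_I2) (auto simp: abs_mult intro!: mult_left_mono)
        qed
        then show "integrable lborel (\<lambda>x. \<integral>a. norm (case (x, a) of (x, a) \<Rightarrow> K x * (?I a * complex_of_real (gauss s x a))) \<partial>lborel)"
          by (simp add: norm_mult)
        show "AE x in lborel. integrable lborel (\<lambda>a. case (x, a) of (x, a) \<Rightarrow> K x * (?I a * complex_of_real (gauss s x a)))"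
          by (auto intro!: integrable_mult_right gauss_le_integrable s I1)
      qed
      from lborel_pair.Fubini_integral[OF this]
      have "(\<integral>x. K x * (\<integral>a. ?I a * complex_of_real (gauss s x a) \<partial>lborel) \<partial>lborel)
        = (\<integral>a. (\<integral>x. ?I a * (K x * complex_of_real (gauss s a x)) \<partial>lborel) \<partial>lborel)"
        by (simp add: gauss_commute mult_ac)
      also have "\<dots> = 0" by (simp add: zero[OF s])
      finally have "complex_of_real (\<delta> ^ DIM('a)) * (\<integral>x. K x * \<psi> s x \<partial>lborel) = 0"
        unfolding sub by (subst integral_mult_right_zero[symmetric]) (simp only: mult.left_commute)
      with \<delta> show ?thesis by simp
    qed
    have lim: "(\<lambda>n. \<psi> (real (Suc n)) x) \<longlonglongrightarrow> ?I x * complex_of_real c" if x: "x \<notin> cbox l u - box l u" for x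
    proof -
      have "(\<lambda>n. \<psi> (real (Suc n)) x) \<longlonglongrightarrow> (\<integral>z. ?I x * complex_of_real (gauss 1 0 (z :: 'a)) \<partial>lborel)"
        unfolding \<psi>_def
      proof (rule integral_dominated_convergence[where w = "gauss 1 (0 :: 'a)"])
        show "AE z in lborel. (\<lambda>n. ?I (x + (1 / sqrt (real (Suc n))) *\<^sub>R z) * complex_of_real (gauss 1 0 z))
          \<longlonglongrightarrow> ?I x * complex_of_real (gauss 1 0 z)"
        proof (rule AE_I2)
          fix z :: 'a
          have "(\<lambda>n. sqrt (1 / real (Suc n))) \<longlonglongrightarrow> sqrt 0"
            by (intro tendsto_real_sqrt LIMSEQ_Suc[OF lim_1_over_n])
          then have "(\<lambda>n. x + (1 / sqrt (real (Suc n))) *\<^sub>R z) \<longlonglongrightarrow> x + (0::real) *\<^sub>R z"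
            by (intro tendsto_intros) (simp add: real_sqrt_divide)
          then have L: "(\<lambda>n. x + (1 / sqrt (real (Suc n))) *\<^sub>R z) \<longlonglongrightarrow> x" by simp
          have "\<forall>\<^sub>F n in sequentially. ?I (x + (1 / sqrt (real (Suc n))) *\<^sub>R z) = ?I x"
          proof (cases "x \<in> box l u")
            case True
            with L have "\<forall>\<^sub>F n in sequentially. x + (1 / sqrt (real (Suc n))) *\<^sub>R z \<in> box l u"
              by (intro topological_tendstoD) auto
            then show ?thesis by eventually_elim (use True in simp)
          next
            case False
            with x have F: "x \<in> - cbox l u" by auto
            with L have "\<forall>\<^sub>F n in sequentially. x + (1 / sqrt (real (Suc n))) *\<^sub>R z \<in> - cbox l u"
              by (intro topological_tendstoD) (auto intro: open_Compl)
            then show ?thesis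
              by eventually_elim (use False box_subset_cbox[of l u] in \<open>auto simp: indicator_def\<close>)
          qed
          then show "(\<lambda>n. ?I (x + (1 / sqrt (real (Suc n))) *\<^sub>R z) * complex_of_real (gauss 1 0 z))
            \<longlonglongrightarrow> ?I x * complex_of_real (gauss 1 0 z)"
            by (intro tendsto_intros tendsto_eventually)
        qed
      qed (auto intro!: gauss_integrable mult_left_le_one_le I1 simp: norm_mult)
      then show ?thesis by (simp add: c_def)
    qed
    have "(\<lambda>n. \<integral>x. K x * \<psi> (real (Suc n)) x \<partial>lborel) \<longlonglongrightarrow> (\<integral>x. K x * (?I x * complex_of_real c) \<partial>lborel)"
    proof (rule integral_dominated_convergence[where w = "\<lambda>x. norm (K x) * c"])
      show "AE x in lborel. (\<lambda>n. K x * \<psi> (real (Suc n)) x) \<longlonglongrightarrow> K x * (?I x * complex_of_real c)"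
        using AE_not_in_box_boundary[of l u] by eventually_elim (intro tendsto_intros lim)
      show "AE x in lborel. norm (K x * \<psi> (real (Suc n)) x) \<le> norm (K x) * c" for n
        by (intro AE_I2) (auto simp: norm_mult intro!: mult_left_mono \<psi>_le)
    qed (use K in auto)
    then have "(\<integral>x. K x * (?I x * complex_of_real c) \<partial>lborel) = 0"
      by (simp add: conv0 LIMSEQ_const_iff)
    then show ?thesis using c by (simp flip: mult.assoc)
  qed
  note zero_box = this
  have int: "integrable lborel (\<lambda>x. K x * indicator (box l u) x)" for l u
    by (rule Bochner_Integration.integrable_bound[OF K]) (auto simp: indicator_def norm_mult)
  have "AE x in lborel. Re (K x) = 0"
  proof (rule AE_zero_if_box_integrals_zero)
    show "(\<integral>x. Re (K x) * indicator (box l u) x \<partial>lborel) = 0" for l u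
    proof -
      have "Re (K x) * indicator (box l u) x = Re (K x * indicator (box l u) x)" for x
        by (simp add: indicator_def)
      then show ?thesis
        using integral_Re[OF int, of l u] by (simp only: zero_box) simp
    qed
  qed (use K in auto)
  moreover have "AE x in lborel. Im (K x) = 0"
  proof (rule AE_zero_if_box_integrals_zero)
    show "(\<integral>x. Im (K x) * indicator (box l u) x \<partial>lborel) = 0" for l u
    proof -
      have "Im (K x) * indicator (box l u) x = Im (K x * indicator (box l u) x)" for x
        by (simp add: indicator_def)
      then show ?thesis
        using integral_Im[OF int, of l u] by (simp only: zero_box) simp
    qed
  qed (use K in auto)
  ultimately show ?thesis
    by eventually_elim (simp add: complex_eq_iff)
qed

text \<open>Completing the square: products of Gaussians are Gaussians. This lets one multiply a square integrable function by a fixed Gaussian, to make it integrable, without leaving the class of test functions.\<close>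

lemma gauss_mult_gauss:
  assumes s: "s > 0"
  shows "gauss s a x * gauss 1 0 x
    = exp (- (s / (s + 1) * (norm a)\<^sup>2 / 2)) * gauss (s + 1) ((s / (s + 1)) *\<^sub>R a) x"
proof -
  define t where "t = s / (s + 1)"
  have t: "(s + 1) * t = s" using s by (simp add: t_def)
  have "(s + 1) * (norm (x - t *\<^sub>R a))\<^sup>2
      = (s + 1) * (norm x)\<^sup>2 - 2 * ((s + 1) * t) * (x \<bullet> a) + ((s + 1) * t) * t * (norm a)\<^sup>2"
    by (simp add: power2_norm_eq_inner inner_diff_left inner_diff_right inner_commute[of a x] algebra_simps)
  also have "\<dots> = s * (norm (x - a))\<^sup>2 + (norm x)\<^sup>2 - s * (norm a)\<^sup>2 + s * t * (norm a)\<^sup>2"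
    unfolding t by (simp add: power2_norm_eq_inner inner_diff_left inner_diff_right inner_commute[of a x] algebra_simps)
  also have "s * t = s - t" using t by (simp add: algebra_simps)
  finally have "(s + 1) * (norm (x - t *\<^sub>R a))\<^sup>2 = s * (norm (x - a))\<^sup>2 + (norm x)\<^sup>2 - t * (norm a)\<^sup>2"
    by (simp add: algebra_simps)
  then show ?thesis
    unfolding gauss_def t_def[symmetric] exp_add[symmetric] by (simp add: field_simps)
qed

lemma energy_gauss_finite:
  assumes "s > 0"
  shows "energy (\<lambda>x. cis (h x) * complex_of_real (gauss s a x)) < \<infinity>"
proof -
  have "energy (\<lambda>x. cis (h x) * complex_of_real (gauss s a x)) \<le> (\<integral>\<^sup>+x. ennreal (gauss s a x) \<partial>lborel)"
    unfolding energy_def using assms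
    by (intro nn_integral_mono ennreal_leI)
       (auto simp: norm_mult power2_eq_square intro!: mult_left_le_one_le gauss_le_1)
  also have "\<dots> < \<infinity>"
    by (subst nn_integral_eq_integral) (auto intro!: gauss_integrable assms)
  finally show ?thesis .
qed

lemma energy_gauss_finite': "s > 0 \<Longrightarrow> energy (\<lambda>x. complex_of_real (gauss s a x)) < \<infinity>"
  using energy_gauss_finite[of s "\<lambda>_. 0" a] by simp

lemma AE_zero_if_gauss_integrals_zero:
  fixes k :: "'a::euclidean_space \<Rightarrow> complex"
  assumes [measurable]: "k \<in> borel_measurable borel" and k: "energy k < \<infinity>"
    and zero: "\<And>s a. s > 0 \<Longrightarrow> (\<integral>x. k x * complex_of_real (gauss s a x) \<partial>lborel) = 0"
  shows "AE x in lborel. k x = 0"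
proof -
  have "AE x in lborel. k x * complex_of_real (gauss 1 0 x) = 0"
  proof (rule AE_zero_if_gauss_integrals_zero_L1)
    show "integrable lborel (\<lambda>x. k x * complex_of_real (gauss 1 0 x))"
      by (intro integrable_mult_energy k energy_gauss_finite') auto
    fix s :: real and a :: 'a assume s: "s > 0"
    have prod: "k x * complex_of_real (gauss 1 0 x) * complex_of_real (gauss s a x)
      = complex_of_real (exp (- (s / (s + 1) * (norm a)\<^sup>2 / 2)))
        * (k x * complex_of_real (gauss (s + 1) ((s / (s + 1)) *\<^sub>R a) x))" for x
      using gauss_mult_gauss[OF s, of a x] by (simp add: mult_ac flip: of_real_mult)
    show "(\<integral>x. k x * complex_of_real (gauss 1 0 x) * complex_of_real (gauss s a x) \<partial>lborel) = 0"
      unfolding prod using s by (simp add: zero)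
  qed
  then show ?thesis
    by eventually_elim (use gauss_pos less_irrefl in \<open>fastforce simp: gauss_def\<close>)
qed

section \<open>Fourier inversion and multipliers\<close>

text \<open>The constant reflects that the phase in \<open>fourier_integral\<close> carries no factor \<open>2 pi\<close>.\<close>

definition inverse_fourier :: "('a::euclidean_space \<Rightarrow> complex) \<Rightarrow> 'a \<Rightarrow> complex" where
  "inverse_fourier G x = complex_of_real (1 / (2 * pi) ^ DIM('a)) * fourier_integral G (- x)"

lemma reflect_measurable:
  fixes F :: "'a::euclidean_space \<Rightarrow> 'b::topological_space"
  assumes "F \<in> borel_measurable borel"
  shows "(\<lambda>x. F (- x)) \<in> borel_measurable borel"
  by (rule measurable_compose[OF _ assms]) (intro borel_measurable_continuous_onI continuous_intros)

lemma inverse_fourier_measurable [measurable]: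
  assumes [measurable]: "G \<in> borel_measurable borel"
  shows "inverse_fourier G \<in> borel_measurable borel"
  unfolding inverse_fourier_def
  by (intro borel_measurable_times borel_measurable_const
        reflect_measurable[OF fourier_integral_measurable[OF assms]])

lemma energy_inverse_fourier_le:
  fixes G :: "'a::euclidean_space \<Rightarrow> complex"
  assumes G: "integrable lborel G"
  shows "energy (inverse_fourier G) \<le> ennreal (1 / (2 * pi) ^ DIM('a)) * energy G"
proof -
  have [measurable]: "G \<in> borel_measurable borel" using G by auto
  define p where "p = (2 * pi) ^ DIM('a)"
  have p: "p > 0" by (simp add: p_def)
  have "energy (\<lambda>x. fourier_integral G (- x)) = energy (fourier_integral G)"
    using nn_integral_affine_isometry[of "-1" "\<lambda>x. ennreal ((norm (fourier_integral G x))\<^sup>2)" 0]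
    by (simp add: energy_def)
  then have "energy (inverse_fourier G) = ennreal ((1 / p)\<^sup>2) * energy (fourier_integral G)"
  proof -
    have meas: "(\<lambda>x. fourier_integral G (- x)) \<in> borel_measurable borel"
      by (rule reflect_measurable[OF fourier_integral_measurable]) measurable
    have "norm (complex_of_real (1 / p)) = 1 / p" using p by (simp only: norm_of_real) simp
    then show ?thesis
      using \<open>energy (\<lambda>x. fourier_integral G (- x)) = _\<close>
      unfolding inverse_fourier_def p_def[symmetric] by (simp only: energy_cmult[OF meas])
  qed
  also have "\<dots> \<le> ennreal ((1 / p)\<^sup>2) * (ennreal p * energy G)"
    unfolding p_def by (intro mult_left_mono fourier_integral_energy_le G) simp
  also have "\<dots> = ennreal (1 / p) * energy G"
    using p by (simp add: mult.assoc[symmetric] ennreal_mult[symmetric] power2_eq_square)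
  finally show ?thesis by (simp add: p_def)
qed

lemma L2_fun_inverse_fourier:
  assumes "integrable lborel G" "energy G < \<infinity>"
  shows "L2_fun (inverse_fourier G)"
  using assms energy_inverse_fourier_le[OF assms(1)]
  by (auto simp: L2_fun_iff ennreal_mult_less_top intro: le_less_trans)

lemma fourier_gauss:
  fixes a :: "'a::euclidean_space"
  assumes "s > 0"
  shows "fourier_integral (\<lambda>x. complex_of_real (gauss s a x)) \<xi>
    = cis (- (a \<bullet> \<xi>)) * complex_of_real (sqrt (2 * pi / s) ^ DIM('a) * gauss (1 / s) 0 \<xi>)"
  using fourier_modulated_gauss[OF assms, of 0 a \<xi>] by simp

text \<open>Let \<open>H\<close> be the transform of the inverse transform of \<open>G\<close>. Two applications of the multiplication formula move both transforms onto a Gaussian, where inversion is an explicit computation. So \<open>H\<close> and \<open>G\<close> have the same integrals against all Gaussians.\<close>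

lemma is_L2_fourier_inverse_fourier:
  fixes G :: "'a::euclidean_space \<Rightarrow> complex"
  assumes G: "integrable lborel G" and e: "energy G < \<infinity>"
  shows "is_L2_fourier (inverse_fourier G) G"
proof -
  have [measurable]: "G \<in> borel_measurable borel" using G by auto
  let ?h = "inverse_fourier G"
  have h: "L2_fun ?h" by (rule L2_fun_inverse_fourier[OF G e])
  obtain H where H: "is_L2_fourier ?h H" using is_L2_fourier_exists[OF h] by blast
  then have [measurable]: "H \<in> borel_measurable borel" and eH: "energy H < \<infinity>"
    by (auto simp: is_L2_fourier_iff L2_fun_iff)
  have "AE \<xi> in lborel. H \<xi> - G \<xi> = 0"
  proof (rule AE_zero_if_gauss_integrals_zero)
    show "energy (\<lambda>\<xi>. H \<xi> - G \<xi>) < \<infinity>" by (rule energy_finite_diff) (use e eH in auto)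
    fix s :: real and a :: 'a assume s: "s > 0"
    let ?g = "\<lambda>x. complex_of_real (gauss s a x)"
    define c where "c = sqrt (2 * pi / s) ^ DIM('a)"
    \<comment> \<open>Up to a constant, \<open>m\<close> is the inverse transform of the Gaussian \<open>?g\<close>.\<close>
    define m where "m x = cis (x \<bullet> a) * complex_of_real (gauss (1 / s) 0 x)" for x
    have m: "integrable lborel m" unfolding m_def using s by (intro modulated_gauss_integrable) simp
    have mhat: "fourier_integral m \<xi> = complex_of_real (sqrt (2 * pi / (1 / s)) ^ DIM('a) * gauss s a \<xi>)" for \<xi>
      using fourier_modulated_gauss[of "1 / s" a 0 \<xi>] s by (simp add: m_def[abs_def])
    have [measurable]: "m \<in> borel_measurable borel" using m by auto
    have gm: "fourier_integral ?g x = complex_of_real c * m (- x)" for x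
      unfolding fourier_gauss[OF s] by (simp add: m_def c_def gauss_def inner_commute mult_ac)
    have "(\<integral>\<xi>. H \<xi> * ?g \<xi> \<partial>lborel) = (\<integral>x. ?h x * fourier_integral ?g x \<partial>lborel)"
      by (rule is_L2_fourier_mult[OF h H _ energy_gauss_finite'[OF s]]) (simp add: gauss_integrable s)
    also have "\<dots> = (\<integral>x. complex_of_real (1 / (2 * pi) ^ DIM('a)) * complex_of_real c * (fourier_integral G (- x) * m (- x)) \<partial>lborel)"
      unfolding gm inverse_fourier_def by (simp only: mult_ac)
    also have "\<dots> = complex_of_real (1 / (2 * pi) ^ DIM('a)) * complex_of_real c * (\<integral>x. fourier_integral G (- x) * m (- x) \<partial>lborel)"
      by (rule integral_mult_right_zero)
    also have "(\<integral>x. fourier_integral G (- x) * m (- x) \<partial>lborel) = (\<integral>x. fourier_integral G x * m x \<partial>lborel)"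
      using integral_affine_isometry[of "-1" "\<lambda>x. fourier_integral G x * m x" 0] by simp
    also have "\<dots> = (\<integral>\<xi>. G \<xi> * fourier_integral m \<xi> \<partial>lborel)"
      by (rule fourier_integral_mult[OF G m])
    also have "\<dots> = (\<integral>\<xi>. complex_of_real (sqrt (2 * pi / (1 / s)) ^ DIM('a)) * (G \<xi> * ?g \<xi>) \<partial>lborel)"
      unfolding mhat of_real_mult by (simp only: mult_ac)
    also have "\<dots> = complex_of_real (sqrt (2 * pi / (1 / s)) ^ DIM('a)) * (\<integral>\<xi>. G \<xi> * ?g \<xi> \<partial>lborel)"
      by (rule integral_mult_right_zero)
    also have "complex_of_real (1 / (2 * pi) ^ DIM('a)) * complex_of_real c * \<dots>
      = complex_of_real (1 / (2 * pi) ^ DIM('a) * (c * sqrt (2 * pi / (1 / s)) ^ DIM('a))) * (\<integral>\<xi>. G \<xi> * ?g \<xi> \<partial>lborel)"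
      unfolding of_real_mult by (simp only: mult_ac)
    also have "\<dots> = (\<integral>\<xi>. G \<xi> * ?g \<xi> \<partial>lborel)"
      unfolding c_def gauss_mass_mult[OF s] by simp
    finally show "(\<integral>\<xi>. (H \<xi> - G \<xi>) * ?g \<xi> \<partial>lborel) = 0"
      unfolding left_diff_distrib
      by (subst Bochner_Integration.integral_diff)
         (auto intro!: integrable_mult_energy e eH energy_gauss_finite' s)
  qed measurable
  then have HG: "AE \<xi> in lborel. H \<xi> = G \<xi>" by eventually_elim simp
  have "energy (\<lambda>\<xi>. F \<xi> - G \<xi>) = energy (\<lambda>\<xi>. F \<xi> - H \<xi>)" for F
    by (rule energy_cong_AE) (use HG in eventually_elim, simp)
  then show ?thesis
    using H e by (simp add: is_L2_fourier_iff L2_fun_iff)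
qed

lemma L2_fourier_inverse_fourier:
  assumes G: "integrable lborel G" and e: "energy G < \<infinity>"
  shows "AE \<xi> in lborel. L2_fourier (inverse_fourier G) \<xi> = G \<xi>"
  using L2_fun_inverse_fourier[OF assms] L2_fourier_is[OF L2_fun_inverse_fourier[OF assms]]
    is_L2_fourier_inverse_fourier[OF assms]
  by (rule is_L2_fourier_unique)

text \<open>Every Gaussian is a multiple of the transform of a modulated Gaussian, so by the multiplication formula its integral against a function is determined by the transform of that function.\<close>

lemma L2_fourier_injective:
  fixes f h :: "'a::euclidean_space \<Rightarrow> complex"
  assumes f: "L2_fun f" and h: "L2_fun h" and eq: "AE \<xi> in lborel. L2_fourier f \<xi> = L2_fourier h \<xi>"
  shows "AE x in lborel. f x = h x"
proof -
  have [measurable]: "f \<in> borel_measurable borel" "h \<in> borel_measurable borel" and e: "energy f < \<infinity>" "energy h < \<infinity>"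
    using f h by (auto simp: L2_fun_iff)
  have [measurable]: "L2_fourier f \<in> borel_measurable borel" "L2_fourier h \<in> borel_measurable borel"
    using L2_fourier_is[OF f] L2_fourier_is[OF h] by (auto simp: is_L2_fourier_iff L2_fun_iff)
  have "AE x in lborel. f x - h x = 0"
  proof (rule AE_zero_if_gauss_integrals_zero)
    show "energy (\<lambda>\<xi>. f \<xi> - h \<xi>) < \<infinity>" by (rule energy_finite_diff) (use e in auto)
    fix s :: real and a :: 'a assume s: "s > 0"
    let ?g = "\<lambda>x. complex_of_real (gauss s a x)"
    define m where "m x = cis (x \<bullet> a) * complex_of_real (gauss (1 / s) 0 x)" for x
    have m: "integrable lborel m" "energy m < \<infinity>" unfolding m_def using s
      by (simp_all add: modulated_gauss_integrable energy_gauss_finite del: infinity_ennreal_def)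
    have [measurable]: "m \<in> borel_measurable borel" using m by auto
    let ?c = "complex_of_real (sqrt (2 * pi / (1 / s)) ^ DIM('a))"
    have c: "?c \<noteq> 0" using s by simp
    have mhat: "fourier_integral m \<xi> = ?c * ?g \<xi>" for \<xi>
      using fourier_modulated_gauss[of "1 / s" a 0 \<xi>] s by (simp add: m_def[abs_def])
    have L: "?c * (\<integral>x. k x * ?g x \<partial>lborel) = (\<integral>\<xi>. L2_fourier k \<xi> * m \<xi> \<partial>lborel)" if k: "L2_fun k" for k
      unfolding is_L2_fourier_mult[OF k L2_fourier_is[OF k] m] mhat
      by (subst integral_mult_right_zero[symmetric]) (simp only: mult_ac)
    have "(\<integral>\<xi>. L2_fourier f \<xi> * m \<xi> \<partial>lborel) = (\<integral>\<xi>. L2_fourier h \<xi> * m \<xi> \<partial>lborel)"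
      by (rule integral_cong_AE) (measurable, use eq in eventually_elim, simp)
    then have "?c * (\<integral>x. f x * ?g x \<partial>lborel) = ?c * (\<integral>x. h x * ?g x \<partial>lborel)"
      by (simp only: L[OF f] L[OF h])
    then have "(\<integral>x. f x * ?g x \<partial>lborel) = (\<integral>x. h x * ?g x \<partial>lborel)"
      using c by (simp only: mult_cancel_left simp_thms)
    then show "(\<integral>x. (f x - h x) * ?g x \<partial>lborel) = 0"
      unfolding left_diff_distrib
      by (subst Bochner_Integration.integral_diff)
         (auto intro!: integrable_mult_energy e energy_gauss_finite' s)
  qed measurable
  then show ?thesis by eventually_elim simp
qed

text \<open>The inverse Fourier integral is a candidate for the function chosen by the multiplier, and injectivity makes it the only one up to null sets.\<close>

lemma fourier_multiplier_AE:
  fixes f :: "'a::euclidean_space \<Rightarrow> complex"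
  assumes f: "AE \<xi> in lborel. L2_fourier f \<xi> = G \<xi>"
    and G: "integrable lborel G" "energy G < \<infinity>"
    and [measurable]: "m \<in> borel_measurable borel" and m: "\<And>\<xi>. norm (m \<xi>) \<le> 1"
  shows "AE x in lborel. fourier_multiplier m f x = inverse_fourier (\<lambda>\<xi>. m \<xi> * G \<xi>) x"
proof -
  have [measurable]: "G \<in> borel_measurable borel" using G by auto
  let ?G = "\<lambda>\<xi>. m \<xi> * G \<xi>"
  have le: "norm (?G \<xi>) \<le> norm (G \<xi>)" for \<xi>
    using m by (simp add: norm_mult mult_left_le_one_le)
  have i: "integrable lborel ?G"
    by (rule Bochner_Integration.integrable_bound[OF G(1)]) (auto simp: le)
  have e: "energy ?G < \<infinity>"
    using G(2) by (rule le_less_trans[OF energy_mono_AE, rotated]) (simp add: le)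
  let ?P = "\<lambda>h. L2_fun h \<and> (AE \<xi> in lborel. L2_fourier h \<xi> = m \<xi> * L2_fourier f \<xi>)"
  have "?P (inverse_fourier ?G)"
    using L2_fun_inverse_fourier[OF i e] L2_fourier_inverse_fourier[OF i e] f
    by (auto elim: eventually_elim2)
  then have P: "?P (fourier_multiplier m f)"
    unfolding fourier_multiplier_def using someI[of ?P] by blast
  show ?thesis
  proof (rule L2_fourier_injective)
    show "AE \<xi> in lborel. L2_fourier (fourier_multiplier m f) \<xi> = L2_fourier (inverse_fourier ?G) \<xi>"
      using conjunct2[OF P] f L2_fourier_inverse_fourier[OF i e] by eventually_elim simp
  qed (use P L2_fun_inverse_fourier[OF i e] in auto)
qed

section \<open>Lower bounds for indicator data\<close>

lemma ennpowr_mono: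
  assumes "x \<le> y" "a \<ge> 0"
  shows "ennpowr x a \<le> ennpowr y a"
proof (cases "y = \<infinity>")
  case False
  then have "enn2real x \<le> enn2real y" using assms by (intro enn2real_mono) (auto simp: less_top)
  moreover have "x \<noteq> \<infinity>" using False assms by (auto simp: top_unique)
  ultimately show ?thesis using False assms by (auto simp: ennpowr_def intro!: ennreal_leI powr_mono2)
qed (simp add: ennpowr_def)

text \<open>Applied below with a norm in \<open>x\<close> as a function of \<open>t\<close>, whose measurability is not clear. The integral of an arbitrary function is the supremum over the simple functions below it, hence still monotone.\<close>

lemma Lp_norm_ge:
  assumes p: "p > 0" and \<kappa>: "\<kappa> \<ge> 0" and E: "E \<in> sets M" "emeasure M E = ennreal \<mu>" and \<mu>: "\<mu> \<ge> 0"
    and h: "AE x in M. x \<in> E \<longrightarrow> ennreal \<kappa> \<le> h x"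
  shows "ennreal (\<kappa> * \<mu> powr (1 / p)) \<le> Lp_norm (ennreal p) M h"
proof -
  have "ennreal (\<kappa> powr p * \<mu>) = (\<integral>\<^sup>+x. ennreal (\<kappa> powr p) * indicator E x \<partial>M)"
    using E \<mu> by (simp add: nn_integral_cmult_indicator ennreal_mult)
  also have "\<dots> \<le> (\<integral>\<^sup>+x. ennpowr (h x) p \<partial>M)"
  proof (rule nn_integral_mono_AE, use h in eventually_elim)
    fix x assume *: "x \<in> E \<longrightarrow> ennreal \<kappa> \<le> h x"
    show "ennreal (\<kappa> powr p) * indicator E x \<le> ennpowr (h x) p"
    proof (cases "x \<in> E")
      case True
      with * p have "ennpowr (ennreal \<kappa>) p \<le> ennpowr (h x) p" by (intro ennpowr_mono) auto
      with True \<kappa> show ?thesis by (simp add: ennpowr_def)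
    qed simp
  qed
  finally have "ennpowr (ennreal (\<kappa> powr p * \<mu>)) (1 / p) \<le> ennpowr (\<integral>\<^sup>+x. ennpowr (h x) p \<partial>M) (1 / p)"
    using p by (intro ennpowr_mono) auto
  moreover have "ennpowr (ennreal (\<kappa> powr p * \<mu>)) (1 / p) = ennreal (\<kappa> * \<mu> powr (1 / p))"
    using p \<kappa> \<mu> by (simp add: ennpowr_def powr_mult powr_powr)
  ultimately show ?thesis
    using p by (simp add: Lp_norm_def)
qed

lemma cos_ge_half:
  fixes x :: real
  assumes "\<bar>x\<bar> \<le> 1"
  shows "cos x \<ge> 1 / 2"
proof -
  have "cos (pi / 3) \<le> cos \<bar>x\<bar>"
    using assms pi_gt3 by (intro cos_monotone_0_pi_le) auto
  then show ?thesis by (simp add: cos_60)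
qed

text \<open>There is no cancellation: after rotation by \<open>- \<theta>\<close> the real part of the integrand is at least \<open>cos 1\<close>, which exceeds one half.\<close>

lemma oscillatory_integral_ge:
  fixes h :: "'a::euclidean_space \<Rightarrow> real"
  assumes [measurable]: "S \<in> sets borel" "h \<in> borel_measurable borel" and S: "emeasure lborel S < \<infinity>"
    and h: "\<And>\<xi>. \<xi> \<in> S \<Longrightarrow> \<bar>h \<xi> - \<theta>\<bar> \<le> 1"
  shows "norm (\<integral>\<xi>. cis (h \<xi>) * indicator S \<xi> \<partial>lborel) \<ge> measure lborel S / 2"
proof -
  have int: "integrable lborel (indicator S :: 'a \<Rightarrow> real)"
    using S by (intro integrable_real_indicator) auto
  have intc: "integrable lborel (\<lambda>\<xi>. cis (h \<xi> - \<theta>) * indicator S \<xi>)"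
    by (rule Bochner_Integration.integrable_bound[OF int]) (auto simp: norm_mult indicator_def)
  have "measure lborel S / 2 = (\<integral>\<xi>. 1 / 2 * indicator S \<xi> \<partial>lborel)"
    by simp
  also have "\<dots> \<le> (\<integral>\<xi>. Re (cis (h \<xi> - \<theta>) * indicator S \<xi>) \<partial>lborel)"
  proof (rule integral_mono[OF _ integrable_Re[OF intc]])
    fix \<xi>
    show "1 / 2 * indicator S \<xi> \<le> Re (cis (h \<xi> - \<theta>) * indicator S \<xi>)"
      using cos_ge_half[OF h] by (simp add: indicator_def)
  qed (use int in simp)
  also have "\<dots> = Re (\<integral>\<xi>. cis (h \<xi> - \<theta>) * indicator S \<xi> \<partial>lborel)"
    by (rule integral_Re[OF intc])
  also have "\<dots> \<le> norm (\<integral>\<xi>. cis (h \<xi> - \<theta>) * indicator S \<xi> \<partial>lborel)"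
    by (rule complex_Re_le_cmod)
  also have "(\<integral>\<xi>. cis (h \<xi> - \<theta>) * indicator S \<xi> \<partial>lborel) = (\<integral>\<xi>. cis (- \<theta>) * (cis (h \<xi>) * indicator S \<xi>) \<partial>lborel)"
    by (simp add: mult.assoc[symmetric] cis_mult)
  also have "norm \<dots> = norm (\<integral>\<xi>. cis (h \<xi>) * indicator S \<xi> \<partial>lborel)"
    by (simp only: integral_mult_right_zero norm_mult norm_cis mult_1)
  finally show ?thesis .
qed

lemma
  fixes S :: "'a::euclidean_space set"
  assumes [measurable]: "S \<in> sets borel" and S: "emeasure lborel S < \<infinity>"
  shows integrable_indicator_complex: "integrable lborel (indicator S :: 'a \<Rightarrow> complex)"
    and energy_indicator: "energy (indicator S) = emeasure lborel S"
proof -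
  have "integrable lborel (indicator S :: 'a \<Rightarrow> real)"
    using S by (intro integrable_real_indicator) auto
  then show "integrable lborel (indicator S :: 'a \<Rightarrow> complex)"
    by (rule Bochner_Integration.integrable_bound) (auto simp: indicator_def)
  have "energy (indicator S) = (\<integral>\<^sup>+x. indicator S x \<partial>lborel)"
    unfolding energy_def by (intro nn_integral_cong) (auto simp: indicator_def)
  then show "energy (indicator S) = emeasure lborel S" by simp
qed

lemma inverse_fourier_indicator_ge:
  fixes S :: "'a::euclidean_space set"
  assumes S: "S \<in> sets borel" "emeasure lborel S < \<infinity>" and [measurable]: "\<phi> \<in> borel_measurable borel"
    and h: "\<And>\<xi>. \<xi> \<in> S \<Longrightarrow> \<bar>x \<bullet> \<xi> + \<phi> \<xi> - \<theta>\<bar> \<le> 1"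
  shows "norm (inverse_fourier (\<lambda>\<xi>. cis (\<phi> \<xi>) * indicator S \<xi>) x) \<ge> measure lborel S / (2 * (2 * pi) ^ DIM('a))"
proof -
  define p where "p = (2 * pi) ^ DIM('a)"
  have p: "p > 0" by (simp add: p_def)
  have "fourier_integral (\<lambda>\<xi>. cis (\<phi> \<xi>) * indicator S \<xi>) (- x) = (\<integral>\<xi>. cis (x \<bullet> \<xi> + \<phi> \<xi>) * indicator S \<xi> \<partial>lborel)"
    by (simp add: fourier_integral_def mult.assoc[symmetric] cis_mult inner_commute)
  then have "measure lborel S / 2 \<le> norm (fourier_integral (\<lambda>\<xi>. cis (\<phi> \<xi>) * indicator S \<xi>) (- x))"
    using oscillatory_integral_ge[OF S(1) _ S(2) h] by simp
  then have "1 / p * (measure lborel S / 2) \<le> 1 / p * norm (fourier_integral (\<lambda>\<xi>. cis (\<phi> \<xi>) * indicator S \<xi>) (- x))"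
    using p by (intro mult_left_mono) auto
  also have "\<dots> = norm (inverse_fourier (\<lambda>\<xi>. cis (\<phi> \<xi>) * indicator S \<xi>) x)"
    using p unfolding inverse_fourier_def p_def[symmetric] norm_mult norm_of_real by simp
  finally show ?thesis unfolding p_def by (simp add: mult.commute)
qed

text \<open>The factor \<open>(2 pi)^(- d)\<close> from the energy bound of the inverse transform is at most 1 and is dropped.\<close>

lemma L2_norm_inverse_fourier_indicator_le:
  fixes S :: "'a::euclidean_space set"
  assumes S: "S \<in> sets borel" "emeasure lborel S < \<infinity>"
  shows "L2_norm (inverse_fourier (indicator S)) \<le> ennreal (sqrt (measure lborel S))"
proof -
  have "(1::real) \<le> (2 * pi) ^ DIM('a)" using pi_gt3 by (intro one_le_power) simp
  then have p: "1 / (2 * pi) ^ DIM('a) \<le> 1" by (simp add: divide_le_eq_1)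
  have "(L2_norm (inverse_fourier (indicator S)))\<^sup>2 \<le> ennreal (1 / (2 * pi) ^ DIM('a)) * energy (indicator S :: 'a \<Rightarrow> complex)"
    unfolding L2_norm_power2 by (rule energy_inverse_fourier_le[OF integrable_indicator_complex[OF S]])
  also have "\<dots> \<le> 1 * energy (indicator S :: 'a \<Rightarrow> complex)"
    using p by (intro mult_right_mono) auto
  also have "\<dots> = (ennreal (sqrt (measure lborel S)))\<^sup>2"
    using S by (simp add: energy_indicator[OF S] ennreal_power emeasure_eq_ennreal_measure less_top)
  finally have *: "(L2_norm (inverse_fourier (indicator S)))\<^sup>2 \<le> (ennreal (sqrt (measure lborel S)))\<^sup>2" .
  show ?thesis
  proof (cases "L2_norm (inverse_fourier (indicator S))")
    case (real l)
    with * have "ennreal (l\<^sup>2) \<le> ennreal ((sqrt (measure lborel S))\<^sup>2)"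
      by (simp add: ennreal_power del: real_sqrt_pow2)
    then have "l\<^sup>2 \<le> (sqrt (measure lborel S))\<^sup>2" by (subst (asm) ennreal_le_iff) auto
    then have "l \<le> sqrt (measure lborel S)" by (rule power2_le_imp_le) simp
    with real show ?thesis by (simp add: ennreal_leI)
  next
    case top
    with * show ?thesis by (simp add: ennreal_power power2_eq_square top_unique flip: ennreal_mult)
  qed
qed

lemma ess_support_subset:
  fixes G :: "'a::euclidean_space \<Rightarrow> complex"
  assumes "AE \<xi> in lborel. G \<xi> = indicator S \<xi>" and "S \<subseteq> T" and "closed T"
  shows "ess_support G \<subseteq> T"
proof -
  have "AE \<xi> in lborel. \<xi> \<in> - T \<longrightarrow> G \<xi> = 0"
    using assms(1) by eventually_elim (use assms(2) in \<open>auto simp: indicator_def\<close>)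
  then have "- T \<subseteq> \<Union>{U. open U \<and> (AE \<xi> in lborel. \<xi> \<in> U \<longrightarrow> G \<xi> = 0)}"
    using assms(3) by (intro Union_upper) (simp add: open_Compl)
  then show ?thesis unfolding ess_support_def by blast
qed

text \<open>The exceptional null set does not depend on \<open>\<theta>\<close>, so that \<open>\<theta>\<close> can be chosen depending on \<open>x\<close>.\<close>

lemma propagator_indicator_AE_ge:
  fixes S :: "'a::euclidean_space set"
  assumes S: "S \<in> sets borel" "emeasure lborel S < \<infinity>" and \<phi>: "\<phi> \<in> borel_measurable borel"
  shows "AE x in lborel. \<forall>\<theta>. (\<forall>\<xi>\<in>S. \<bar>x \<bullet> \<xi> + \<phi> \<xi> - \<theta>\<bar> \<le> 1) \<longrightarrow>
    measure lborel S / (2 * (2 * pi) ^ DIM('a))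
      \<le> norm (fourier_multiplier (\<lambda>\<xi>. cis (\<phi> \<xi>)) (inverse_fourier (indicator S)) x)"
proof -
  note i = integrable_indicator_complex[OF S]
  have e: "energy (indicator S :: 'a \<Rightarrow> complex) < \<infinity>" using energy_indicator[OF S] S by simp
  have "AE x in lborel. fourier_multiplier (\<lambda>\<xi>. cis (\<phi> \<xi>)) (inverse_fourier (indicator S)) x
     = inverse_fourier (\<lambda>\<xi>. cis (\<phi> \<xi>) * indicator S \<xi>) x"
    using \<phi> by (intro fourier_multiplier_AE[OF L2_fourier_inverse_fourier[OF i e] i e]) auto
  then show ?thesis
    by eventually_elim (use inverse_fourier_indicator_ge[OF S \<phi>] in auto)
qed

lemma mixed_norm_indicator_data_ge:
  fixes A B :: "'a::euclidean_space set"
  assumes A: "A \<in> sets borel" "emeasure lborel A < \<infinity>" and B: "B \<in> sets borel" "emeasure lborel B < \<infinity>"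
    and I: "I \<in> sets borel" "emeasure lborel I = ennreal T" "T \<ge> 0"
    and V: "\<And>t. V t \<in> sets borel" "\<And>t. emeasure lborel (V t) = ennreal v" "v \<ge> 0"
    and phA: "\<And>t x. t \<in> I \<Longrightarrow> x \<in> V t \<Longrightarrow> \<exists>\<theta>. \<forall>\<xi>\<in>A. \<bar>x \<bullet> \<xi> + t * norm \<xi> - \<theta>\<bar> \<le> 1"
    and phB: "\<And>t x. t \<in> I \<Longrightarrow> x \<in> V t \<Longrightarrow> \<exists>\<theta>. \<forall>\<xi>\<in>B. \<bar>x \<bullet> \<xi> - t * (norm \<xi>)\<^sup>2 - \<theta>\<bar> \<le> 1"
    and q: "q > 0" and r: "r > 0"
  shows "ennreal (measure lborel A * measure lborel B / (2 * (2 * pi) ^ DIM('a))\<^sup>2 * v powr (1 / r) * T powr (1 / q))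
    \<le> mixed_norm (ennreal q) (ennreal r)
      (\<lambda>t x. wave_propagator t (inverse_fourier (indicator A)) x
           * schroedinger_propagator t (inverse_fourier (indicator B)) x)"
proof -
  define \<kappa> where "\<kappa> = measure lborel A * measure lborel B / (2 * (2 * pi) ^ DIM('a))\<^sup>2"
  have \<kappa>: "\<kappa> \<ge> 0" by (simp add: \<kappa>_def)
  define P where "P t x = wave_propagator t (inverse_fourier (indicator A)) x
           * schroedinger_propagator t (inverse_fourier (indicator B)) x" for t x
  have "ennreal (\<kappa> * v powr (1 / r)) \<le> Lp_norm (ennreal r) lborel (\<lambda>x. ennreal (norm (P t x)))" if t: "t \<in> I" for t
  proof (rule Lp_norm_ge[OF r \<kappa> _ V(2)])
    have "AE x in lborel. \<forall>\<theta>. (\<forall>\<xi>\<in>A. \<bar>x \<bullet> \<xi> + t * norm \<xi> - \<theta>\<bar> \<le> 1) \<longrightarrow>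
       measure lborel A / (2 * (2 * pi) ^ DIM('a)) \<le> norm (wave_propagator t (inverse_fourier (indicator A)) x)"
      unfolding wave_propagator_def by (rule propagator_indicator_AE_ge[OF A]) simp
    moreover have "AE x in lborel. \<forall>\<theta>. (\<forall>\<xi>\<in>B. \<bar>x \<bullet> \<xi> + - (t * (norm \<xi>)\<^sup>2) - \<theta>\<bar> \<le> 1) \<longrightarrow>
       measure lborel B / (2 * (2 * pi) ^ DIM('a)) \<le> norm (schroedinger_propagator t (inverse_fourier (indicator B)) x)"
      unfolding schroedinger_propagator_def by (rule propagator_indicator_AE_ge[OF B]) simp
    ultimately show "AE x in lborel. x \<in> V t \<longrightarrow> ennreal \<kappa> \<le> ennreal (norm (P t x))"
    proof eventually_elim
      case (elim x)
      show ?case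
      proof (intro impI ennreal_leI)
        assume x: "x \<in> V t"
        have a: "measure lborel A / (2 * (2 * pi) ^ DIM('a)) \<le> norm (wave_propagator t (inverse_fourier (indicator A)) x)"
          using elim(1) phA[OF t x] by blast
        have b: "measure lborel B / (2 * (2 * pi) ^ DIM('a)) \<le> norm (schroedinger_propagator t (inverse_fourier (indicator B)) x)"
          using elim(2) phB[OF t x] by auto
        have "\<kappa> = measure lborel A / (2 * (2 * pi) ^ DIM('a)) * (measure lborel B / (2 * (2 * pi) ^ DIM('a)))"
          by (simp add: \<kappa>_def power2_eq_square)
        also have "\<dots> \<le> norm (P t x)"
          unfolding P_def norm_mult by (intro mult_mono a b) auto
        finally show "\<kappa> \<le> norm (P t x)" .
      qed
    qed
  qed (use V in auto)
  then have "ennreal (\<kappa> * v powr (1 / r) * T powr (1 / q)) \<le> mixed_norm (ennreal q) (ennreal r) P"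
    unfolding mixed_norm_def using \<kappa> I
    by (intro Lp_norm_ge[OF q]) auto
  then show ?thesis unfolding \<kappa>_def P_def .
qed

text \<open>What the bilinear estimate says about indicator data whose phases are nearly constant: with \<open>|A| |B|\<close> on the left and its square root on the right, one square root remains.\<close>

lemma bilinear_estimate_test:
  fixes A B :: "'a::euclidean_space set"
  assumes A: "A \<in> sets borel" "emeasure lborel A < \<infinity>" and B: "B \<in> sets borel" "emeasure lborel B < \<infinity>"
    and pos: "measure lborel A > 0" "measure lborel B > 0"
    and I: "I \<in> sets borel" "emeasure lborel I = ennreal T" "T \<ge> 0"
    and V: "\<And>t. V t \<in> sets borel" "\<And>t. emeasure lborel (V t) = ennreal v" "v \<ge> 0"
    and phA: "\<And>t x. t \<in> I \<Longrightarrow> x \<in> V t \<Longrightarrow> \<exists>\<theta>. \<forall>\<xi>\<in>A. \<bar>x \<bullet> \<xi> + t * norm \<xi> - \<theta>\<bar> \<le> 1"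
    and phB: "\<And>t x. t \<in> I \<Longrightarrow> x \<in> V t \<Longrightarrow> \<exists>\<theta>. \<forall>\<xi>\<in>B. \<bar>x \<bullet> \<xi> - t * (norm \<xi>)\<^sup>2 - \<theta>\<bar> \<le> 1"
    and q: "q > 0" and r: "r > 0" and C: "C \<ge> 0"
    and closed: "closed X" "closed Y" and sub: "A \<subseteq> X" "B \<subseteq> Y"
    and est: "\<And>f g :: 'a \<Rightarrow> complex. L2_fun f \<Longrightarrow> L2_fun g \<Longrightarrow>
      ess_support (L2_fourier f) \<subseteq> X \<Longrightarrow> ess_support (L2_fourier g) \<subseteq> Y \<Longrightarrow>
      mixed_norm (ennreal q) (ennreal r) (\<lambda>t x. wave_propagator t f x * schroedinger_propagator t g x)
        \<le> ennreal C * L2_norm f * L2_norm g"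
  shows "sqrt (measure lborel A * measure lborel B) * v powr (1 / r) * T powr (1 / q) \<le> C * (2 * (2 * pi) ^ DIM('a))\<^sup>2"
proof -
  define p where "p = (2 * (2 * pi) ^ DIM('a))\<^sup>2"
  have p: "p > 0" by (simp add: p_def)
  let ?a = "measure lborel A" and ?b = "measure lborel B"
  let ?f = "inverse_fourier (indicator A)" and ?g = "inverse_fourier (indicator B)"
  have iA: "integrable lborel (indicator A :: 'a \<Rightarrow> complex)" "energy (indicator A :: 'a \<Rightarrow> complex) < \<infinity>"
    using A by (auto simp: energy_indicator intro: integrable_indicator_complex)
  have iB: "integrable lborel (indicator B :: 'a \<Rightarrow> complex)" "energy (indicator B :: 'a \<Rightarrow> complex) < \<infinity>"
    using B by (auto simp: energy_indicator intro: integrable_indicator_complex)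
  have "ennreal (?a * ?b / p * v powr (1 / r) * T powr (1 / q)) \<le> ennreal C * L2_norm ?f * L2_norm ?g"
    unfolding p_def
    by (rule order_trans[OF mixed_norm_indicator_data_ge[OF A B I V phA phB q r]], assumption+,
        rule est[OF L2_fun_inverse_fourier[OF iA] L2_fun_inverse_fourier[OF iB]
          ess_support_subset[OF L2_fourier_inverse_fourier[OF iA] sub(1) closed(1)]
          ess_support_subset[OF L2_fourier_inverse_fourier[OF iB] sub(2) closed(2)]])
  also have "\<dots> \<le> ennreal C * ennreal (sqrt ?a) * ennreal (sqrt ?b)"
    by (intro mult_mono L2_norm_inverse_fourier_indicator_le A B) auto
  also have "\<dots> = ennreal (C * sqrt (?a * ?b))"
    using C by (simp add: real_sqrt_mult ennreal_mult mult.assoc)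
  finally have "?a * ?b / p * v powr (1 / r) * T powr (1 / q) \<le> C * sqrt (?a * ?b)"
    using C by (subst (asm) ennreal_le_iff) auto
  moreover have "?a * ?b = sqrt (?a * ?b) * sqrt (?a * ?b)" by simp
  ultimately have "sqrt (?a * ?b) * (sqrt (?a * ?b) * v powr (1 / r) * T powr (1 / q)) \<le> sqrt (?a * ?b) * (C * p)"
    using p by (simp add: field_simps)
  moreover have "sqrt (?a * ?b) > 0" using pos by simp
  ultimately show ?thesis unfolding p_def[symmetric] by (simp only: mult_le_cancel_left_pos)
qed

text \<open>The set on the left is the image of a slab under the shear \<open>x \<mapsto> x + p(x) b\<close>. Its measure is found by double counting pairs \<open>(x, s)\<close> with \<open>x\<close> in this set and \<open>x \<bullet> b + s\<close> in the unit interval: for fixed \<open>x\<close> the admissible \<open>s\<close> form an interval of length 1, and after translation by \<open>s b\<close> the pairs lie over the unit slab, with \<open>s\<close> in an interval of length \<open>2 \<delta>\<close>.\<close>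

lemma emeasure_shear:
  fixes b :: "'a::euclidean_space" and p :: "'a \<Rightarrow> real"
  assumes b: "b \<in> Basis" and Q [measurable]: "Q \<in> sets borel" and p [measurable]: "p \<in> borel_measurable borel"
    and inv: "\<And>x s. x - s *\<^sub>R b \<in> Q \<longleftrightarrow> x \<in> Q" "\<And>x s. p (x - s *\<^sub>R b) = p x" and \<delta>: "\<delta> \<ge> 0"
  shows "emeasure lborel {x \<in> Q. \<bar>x \<bullet> b - p x\<bar> \<le> \<delta>} = ennreal (2 * \<delta>) * emeasure lborel {x \<in> Q. 0 \<le> x \<bullet> b \<and> x \<bullet> b \<le> 1}"
proof -
  let ?B = "{x \<in> Q. \<bar>x \<bullet> b - p x\<bar> \<le> \<delta>}" and ?U = "{x \<in> Q. 0 \<le> x \<bullet> b \<and> x \<bullet> b \<le> 1}"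
  have B [measurable]: "?B \<in> sets borel" and U [measurable]: "?U \<in> sets borel"
    using Q by measurable
  have len: "(\<integral>\<^sup>+s. indicator {l..u} (c + s) \<partial>lborel) = ennreal (u - l)"
    "(\<integral>\<^sup>+s. indicator {l..u} (c - s) \<partial>lborel) = ennreal (u - l)" if "l \<le> u" for l u c :: real
    using nn_integral_affine_isometry[of 1 "indicator {l..u}" c] nn_integral_affine_isometry[of "-1" "indicator {l..u}" c] that
    by simp_all
  have "emeasure lborel ?B = (\<integral>\<^sup>+x. indicator ?B x * (\<integral>\<^sup>+s. indicator {0..1} (x \<bullet> b + s) \<partial>lborel) \<partial>lborel)"
    by (simp add: len)
  also have "\<dots> = (\<integral>\<^sup>+x. \<integral>\<^sup>+s. indicator ?B x * indicator {0..1} (x \<bullet> b + s) \<partial>lborel \<partial>lborel)"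
    by (intro nn_integral_cong nn_integral_cmult[symmetric]) measurable
  also have "\<dots> = (\<integral>\<^sup>+s. \<integral>\<^sup>+x. indicator ?B x * indicator {0..1} (x \<bullet> b + s) \<partial>lborel \<partial>lborel)"
    by (rule lborel_pair.Fubini'[symmetric]) measurable
  also have "\<dots> = (\<integral>\<^sup>+s. \<integral>\<^sup>+x. indicator ?U x * indicator {-\<delta>..\<delta>} (x \<bullet> b - p x - s) \<partial>lborel \<partial>lborel)"
  proof (rule nn_integral_cong)
    fix s :: real
    have "(\<integral>\<^sup>+x. indicator ?B x * indicator {0..1} (x \<bullet> b + s) \<partial>lborel)
      = (\<integral>\<^sup>+x. indicator ?B (- (s *\<^sub>R b) + 1 *\<^sub>R x) * indicator {0..1} ((- (s *\<^sub>R b) + 1 *\<^sub>R x) \<bullet> b + s) \<partial>lborel)"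
      by (rule nn_integral_affine_isometry[symmetric]) (simp, measurable)
    also have "\<dots> = (\<integral>\<^sup>+x. indicator ?U x * indicator {-\<delta>..\<delta>} (x \<bullet> b - p x - s) \<partial>lborel)"
      using b inv[of _ s] by (intro nn_integral_cong) (auto simp: indicator_def inner_diff_left inner_Basis)
    finally show "(\<integral>\<^sup>+x. indicator ?B x * indicator {0..1} (x \<bullet> b + s) \<partial>lborel)
      = (\<integral>\<^sup>+x. indicator ?U x * indicator {-\<delta>..\<delta>} (x \<bullet> b - p x - s) \<partial>lborel)" .
  qed
  also have "\<dots> = (\<integral>\<^sup>+x. \<integral>\<^sup>+s. indicator ?U x * indicator {-\<delta>..\<delta>} (x \<bullet> b - p x - s) \<partial>lborel \<partial>lborel)"
    by (rule lborel_pair.Fubini') measurable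
  also have "\<dots> = (\<integral>\<^sup>+x. indicator ?U x * (\<integral>\<^sup>+s. indicator {-\<delta>..\<delta>} (x \<bullet> b - p x - s) \<partial>lborel) \<partial>lborel)"
    by (intro nn_integral_cong nn_integral_cmult) measurable
  also have "\<dots> = (\<integral>\<^sup>+x. ennreal (2 * \<delta>) * indicator ?U x \<partial>lborel)"
    using \<delta> by (intro nn_integral_cong) (simp add: len mult.commute)
  also have "\<dots> = ennreal (2 * \<delta>) * emeasure lborel ?U"
    by (rule nn_integral_cmult_indicator) simp
  finally show ?thesis .
qed

section \<open>The resonant example\<close>

lemma
  fixes l u :: "'n::finite \<Rightarrow> real"
  assumes "\<And>k. l k \<le> u k"
  shows coordinate_box_borel: "{x::real^'n. \<forall>k. l k \<le> x $ k \<and> x $ k \<le> u k} \<in> sets borel"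
    and emeasure_coordinate_box:
      "emeasure lborel {x::real^'n. \<forall>k. l k \<le> x $ k \<and> x $ k \<le> u k} = ennreal (\<Prod>k\<in>UNIV. u k - l k)"
proof -
  let ?a = "\<chi> k. l k" and ?b = "\<chi> k. u k"
  have eq: "{x::real^'n. \<forall>k. l k \<le> x $ k \<and> x $ k \<le> u k} = cbox ?a ?b"
    by (auto simp: mem_box_cart)
  show "{x::real^'n. \<forall>k. l k \<le> x $ k \<and> x $ k \<le> u k} \<in> sets borel"
    unfolding eq by simp
  have "cbox ?a ?b \<noteq> {}"
    using assms by (auto simp: interval_ne_empty_cart)
  then have "measure lborel (cbox ?a ?b) = (\<Prod>k\<in>UNIV. u k - l k)"
    by (subst content_cbox_cart) auto
  then show "emeasure lborel {x::real^'n. \<forall>k. l k \<le> x $ k \<and> x $ k \<le> u k} = ennreal (\<Prod>k\<in>UNIV. u k - l k)"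
    unfolding eq using emeasure_lborel_cbox_finite[of ?a ?b]
    by (subst emeasure_eq_ennreal_measure) (auto simp: less_top)
qed

lemma prod_distinguish_one:
  fixes i :: "'n::finite"
  shows "(\<Prod>k\<in>UNIV. if k = i then \<alpha> else \<beta>) = \<alpha> * \<beta> ^ (CARD('n) - 1)"
proof -
  have "(\<Prod>k\<in>UNIV - {i}. if k = i then \<alpha> else \<beta>) = (\<Prod>k\<in>UNIV - {i}. \<beta>)"
    by (rule prod.cong) auto
  then show ?thesis
    by (subst prod.remove[of _ i]) (auto simp: card_Diff_subset)
qed

lemma prod_distinguish_two:
  fixes i j :: "'n::finite"
  assumes "i \<noteq> j"
  shows "(\<Prod>k\<in>UNIV. if k = i then \<alpha> else if k = j then \<gamma> else \<beta>) = \<alpha> * \<gamma> * \<beta> ^ (CARD('n) - 2)"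
proof -
  have "(\<Prod>k\<in>UNIV - {i} - {j}. if k = i then \<alpha> else if k = j then \<gamma> else \<beta>) = (\<Prod>k\<in>UNIV - {i} - {j}. \<beta>)"
    by (rule prod.cong) auto
  then show ?thesis
    using assms by (subst prod.remove[of _ i], simp, simp, subst prod.remove[of _ j])
      (auto simp: card_Diff_subset Diff_insert2[symmetric] numeral_2_eq_2 mult.assoc)
qed

lemma abs_sum_le_card:
  fixes f :: "'n::finite \<Rightarrow> real"
  assumes "\<And>k. k \<in> K \<Longrightarrow> \<bar>f k\<bar> \<le> M" and "M \<ge> 0"
  shows "\<bar>\<Sum>k\<in>K. f k\<bar> \<le> real CARD('n) * M"
proof -
  have "\<bar>\<Sum>k\<in>K. f k\<bar> \<le> (\<Sum>k\<in>K. \<bar>f k\<bar>)" by (rule sum_abs)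
  also have "\<dots> \<le> real (card K) * M" by (rule sum_bounded_above) (rule assms(1))
  also have "\<dots> \<le> real CARD('n) * M"
    using assms(2) by (intro mult_right_mono) (auto intro: card_mono)
  finally show ?thesis .
qed

text \<open>The frequency set of the wave. The widths are those for which \<open>|\<xi>| - \<xi>_i\<close> is of order \<open>1 / \<rho>^4\<close>.\<close>

definition wave_box :: "'n::finite \<Rightarrow> real \<Rightarrow> real \<Rightarrow> (real ^ 'n) set" where
  "wave_box i c \<rho> = {\<xi>. \<forall>k. \<bar>\<xi> $ k - axis i 1 $ k\<bar> \<le> (if k = i then c / \<rho> else c / \<rho>\<^sup>2)}"

text \<open>The frequency set of the Schroedinger solution: near \<open>- (e_i + e_j) / 2\<close>, a thin neighbourhood of a surface on which the phase, seen in the frame of the wave, depends on time only through terms of size \<open>1 / \<rho>^4\<close>. The exact surface is \<open>b - b^2 = a^2 + |\<eta>'|^2\<close>, where \<open>a\<close>, \<open>b\<close> and \<open>\<eta>'\<close> are the offsets from the centre; the parabola \<open>b = a^2\<close> differs from it by an error of the size of the thickness.\<close>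

definition parabola_slab :: "'n::finite \<Rightarrow> 'n \<Rightarrow> real \<Rightarrow> real \<Rightarrow> (real ^ 'n) set" where
  "parabola_slab i j c \<rho> = {\<xi>. \<bar>\<xi> $ i + 1 / 2\<bar> \<le> c / \<rho> \<and> (\<forall>k. k \<noteq> i \<and> k \<noteq> j \<longrightarrow> \<bar>\<xi> $ k\<bar> \<le> c / \<rho>\<^sup>2)
     \<and> \<bar>\<xi> $ j + 1 / 2 - (\<xi> $ i + 1 / 2)\<^sup>2\<bar> \<le> c / \<rho> ^ 4}"

text \<open>The region at time \<open>t\<close> on which both solutions stay in phase; it moves with the velocity \<open>- e_i\<close> of the wave.\<close>

definition comoving_box :: "'n::finite \<Rightarrow> real \<Rightarrow> real \<Rightarrow> (real ^ 'n) set" where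
  "comoving_box i \<rho> t = {x. \<bar>x $ i + t\<bar> \<le> \<rho> \<and> (\<forall>k. k \<noteq> i \<longrightarrow> \<bar>x $ k\<bar> \<le> \<rho>\<^sup>2)}"

lemma
  fixes i :: "'n::finite"
  assumes c: "c > 0" and \<rho>: "\<rho> > 0"
  shows wave_box_borel: "wave_box i c \<rho> \<in> sets borel"
    and emeasure_wave_box: "emeasure lborel (wave_box i c \<rho>) = ennreal (2 * c / \<rho> * (2 * c / \<rho>\<^sup>2) ^ (CARD('n) - 1))"
proof -
  define w where "w k = (if k = i then c / \<rho> else c / \<rho>\<^sup>2)" for k
  have w: "w k \<ge> 0" for k using c \<rho> by (simp add: w_def)
  have eq: "wave_box i c \<rho> = {x. \<forall>k. axis i 1 $ k - w k \<le> x $ k \<and> x $ k \<le> axis i 1 $ k + w k}"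
    unfolding wave_box_def w_def[symmetric] by (auto simp: abs_le_iff algebra_simps)
  show "wave_box i c \<rho> \<in> sets borel"
    unfolding eq using w by (intro coordinate_box_borel) (simp add: order_trans[of _ "axis i 1 $ _"])
  have "emeasure lborel (wave_box i c \<rho>) = ennreal (\<Prod>k\<in>UNIV. (axis i 1 $ k + w k) - (axis i 1 $ k - w k))"
    unfolding eq using w by (intro emeasure_coordinate_box) (simp add: order_trans[of _ "axis i 1 $ _"])
  also have "(\<Prod>k\<in>UNIV. (axis i 1 $ k + w k) - (axis i 1 $ k - w k))
      = (\<Prod>k\<in>UNIV. if k = i then 2 * c / \<rho> else 2 * c / \<rho>\<^sup>2)"
    by (rule prod.cong) (auto simp: w_def)
  finally show "emeasure lborel (wave_box i c \<rho>) = ennreal (2 * c / \<rho> * (2 * c / \<rho>\<^sup>2) ^ (CARD('n) - 1))"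
    by (simp only: prod_distinguish_one)
qed

lemma
  fixes i :: "'n::finite"
  assumes \<rho>: "\<rho> > 0"
  shows comoving_box_borel: "comoving_box i \<rho> t \<in> sets borel"
    and emeasure_comoving_box: "emeasure lborel (comoving_box i \<rho> t) = ennreal (2 * \<rho> * (2 * \<rho>\<^sup>2) ^ (CARD('n) - 1))"
proof -
  define l where "l k = (if k = i then - t - \<rho> else - \<rho>\<^sup>2)" for k
  define u where "u k = (if k = i then - t + \<rho> else \<rho>\<^sup>2)" for k
  have lu: "l k \<le> u k" for k using \<rho> by (simp add: l_def u_def)
  have ab: "\<bar>y\<bar> \<le> z \<longleftrightarrow> - z \<le> y \<and> y \<le> z" for y z :: real by auto
  have eq: "comoving_box i \<rho> t = {x. \<forall>k. l k \<le> x $ k \<and> x $ k \<le> u k}"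
    unfolding comoving_box_def l_def u_def by (auto simp: ab algebra_simps split: if_splits)
  show "comoving_box i \<rho> t \<in> sets borel"
    unfolding eq by (intro coordinate_box_borel lu)
  have "emeasure lborel (comoving_box i \<rho> t) = ennreal (\<Prod>k\<in>UNIV. u k - l k)"
    unfolding eq by (intro emeasure_coordinate_box lu)
  also have "(\<Prod>k\<in>UNIV. u k - l k) = (\<Prod>k\<in>UNIV. if k = i then 2 * \<rho> else 2 * \<rho>\<^sup>2)"
    by (rule prod.cong) (auto simp: u_def l_def)
  finally show "emeasure lborel (comoving_box i \<rho> t) = ennreal (2 * \<rho> * (2 * \<rho>\<^sup>2) ^ (CARD('n) - 1))"
    by (simp only: prod_distinguish_one)
qed

lemma
  fixes i j :: "'n::finite"
  assumes ij: "i \<noteq> j" and c: "c > 0" and \<rho>: "\<rho> > 0"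
  shows parabola_slab_borel: "parabola_slab i j c \<rho> \<in> sets borel"
    and emeasure_parabola_slab: "emeasure lborel (parabola_slab i j c \<rho>)
      = ennreal (2 * c / \<rho> ^ 4 * (2 * c / \<rho> * (2 * c / \<rho>\<^sup>2) ^ (CARD('n) - 2)))"
proof -
  define Q :: "(real ^ 'n) set" where
    "Q = {\<xi>. \<bar>\<xi> $ i + 1 / 2\<bar> \<le> c / \<rho> \<and> (\<forall>k. k \<noteq> i \<and> k \<noteq> j \<longrightarrow> \<bar>\<xi> $ k\<bar> \<le> c / \<rho>\<^sup>2)}"
  define p :: "real ^ 'n \<Rightarrow> real" where "p \<xi> = (\<xi> $ i + 1 / 2)\<^sup>2 - 1 / 2" for \<xi>
  let ?b = "axis j 1 :: real ^ 'n"
  have b: "?b \<in> Basis" by (simp add: axis_in_Basis_iff)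
  have bi: "\<xi> \<bullet> ?b = \<xi> $ j" for \<xi> :: "real ^ 'n" by (simp add: inner_axis)
  have "closed Q"
    unfolding Q_def
    by (intro closed_Collect_conj closed_Collect_le closed_Collect_all closed_Collect_imp continuous_intros) auto
  then have Q: "Q \<in> sets borel" by simp
  have p: "p \<in> borel_measurable borel"
    unfolding p_def by (intro borel_measurable_continuous_onI continuous_intros)
  have inv: "x - s *\<^sub>R ?b \<in> Q \<longleftrightarrow> x \<in> Q" "p (x - s *\<^sub>R ?b) = p x" for x s
    using ij unfolding Q_def p_def by (auto simp: axis_def)
  have eq: "parabola_slab i j c \<rho> = {x \<in> Q. \<bar>x \<bullet> ?b - p x\<bar> \<le> c / \<rho> ^ 4}"
    unfolding parabola_slab_def Q_def p_def bi by (auto simp: algebra_simps)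
  show "parabola_slab i j c \<rho> \<in> sets borel"
    unfolding eq using Q p by measurable
  define l where "l k = (if k = i then - 1 / 2 - c / \<rho> else if k = j then 0 else - c / \<rho>\<^sup>2)" for k
  define u where "u k = (if k = i then - 1 / 2 + c / \<rho> else if k = j then 1 else c / \<rho>\<^sup>2)" for k
  have lu: "l k \<le> u k" for k using \<rho> c by (simp add: l_def u_def)
  have "{x \<in> Q. 0 \<le> x \<bullet> ?b \<and> x \<bullet> ?b \<le> 1} = {x. \<forall>k. l k \<le> x $ k \<and> x $ k \<le> u k}"
  proof (rule set_eqI)
    fix x :: "real ^ 'n"
    have "\<bar>x $ i + 1 / 2\<bar> \<le> c / \<rho> \<longleftrightarrow> l i \<le> x $ i \<and> x $ i \<le> u i"
      by (auto simp: l_def u_def)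
    moreover have "\<bar>x $ k\<bar> \<le> c / \<rho>\<^sup>2 \<longleftrightarrow> l k \<le> x $ k \<and> x $ k \<le> u k" if "k \<noteq> i" "k \<noteq> j" for k
      using that by (auto simp: l_def u_def)
    moreover have "0 \<le> x $ j \<and> x $ j \<le> 1 \<longleftrightarrow> l j \<le> x $ j \<and> x $ j \<le> u j"
      using ij by (auto simp: l_def u_def)
    ultimately show "x \<in> {x \<in> Q. 0 \<le> x \<bullet> ?b \<and> x \<bullet> ?b \<le> 1}
        \<longleftrightarrow> x \<in> {x. \<forall>k. l k \<le> x $ k \<and> x $ k \<le> u k}"
      unfolding Q_def bi mem_Collect_eq by metis
  qed
  then have "emeasure lborel {x \<in> Q. 0 \<le> x \<bullet> ?b \<and> x \<bullet> ?b \<le> 1} = ennreal (\<Prod>k\<in>UNIV. u k - l k)"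
    using emeasure_coordinate_box[OF lu] by simp
  also have "(\<Prod>k\<in>UNIV. u k - l k) = (\<Prod>k\<in>UNIV. if k = i then 2 * c / \<rho> else if k = j then 1 else 2 * c / \<rho>\<^sup>2)"
    by (rule prod.cong) (auto simp: u_def l_def)
  also have "\<dots> = 2 * c / \<rho> * (2 * c / \<rho>\<^sup>2) ^ (CARD('n) - 2)"
    by (simp only: prod_distinguish_two[OF ij] mult_1_right)
  finally have U: "emeasure lborel {x \<in> Q. 0 \<le> x \<bullet> ?b \<and> x \<bullet> ?b \<le> 1} = ennreal (2 * c / \<rho> * (2 * c / \<rho>\<^sup>2) ^ (CARD('n) - 2))" .
  have "emeasure lborel (parabola_slab i j c \<rho>)
      = ennreal (2 * (c / \<rho> ^ 4)) * ennreal (2 * c / \<rho> * (2 * c / \<rho>\<^sup>2) ^ (CARD('n) - 2))"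
    unfolding eq U[symmetric] using c \<rho> by (intro emeasure_shear b Q p inv) simp
  also have "\<dots> = ennreal (2 * c / \<rho> ^ 4 * (2 * c / \<rho> * (2 * c / \<rho>\<^sup>2) ^ (CARD('n) - 2)))"
    using c \<rho> by (subst ennreal_mult[symmetric]) auto
  finally show "emeasure lborel (parabola_slab i j c \<rho>)
      = ennreal (2 * c / \<rho> ^ 4 * (2 * c / \<rho> * (2 * c / \<rho>\<^sup>2) ^ (CARD('n) - 2)))" .
qed

lemma divide_scale_le:
  fixes c \<rho> :: real
  assumes "c > 0" "\<rho> \<ge> 1"
  shows "c / \<rho> ^ n \<le> c"
  using assms by (simp add: divide_le_eq mult_left_le one_le_power)

lemma wave_box_subset:
  fixes i :: "'n::finite"
  assumes c: "c > 0" and \<rho>: "\<rho> \<ge> 1" and \<epsilon>: "real CARD('n) * c \<le> \<epsilon>"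
  shows "wave_box i c \<rho> \<subseteq> {\<xi>. norm (\<xi> - axis i 1) \<le> \<epsilon>}"
proof
  fix \<xi> :: "real ^ 'n" assume \<xi>: "\<xi> \<in> wave_box i c \<rho>"
  have "\<bar>(\<xi> - axis i 1) $ k\<bar> \<le> c" for k
    using \<xi> divide_scale_le[OF c \<rho>, of 1] divide_scale_le[OF c \<rho>, of 2]
    unfolding wave_box_def by (auto dest!: spec[of _ k] split: if_splits)
  then have "(\<Sum>k\<in>UNIV. \<bar>(\<xi> - axis i 1) $ k\<bar>) \<le> real CARD('n) * c"
    by (rule sum_bounded_above)
  with norm_le_l1_cart[of "\<xi> - axis i 1"] \<epsilon>
  show "\<xi> \<in> {\<xi>. norm (\<xi> - axis i 1) \<le> \<epsilon>}" by simp
qed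

lemma parabola_slab_height:
  assumes c: "0 < c" "c \<le> 1" and \<rho>: "\<rho> \<ge> 1" and \<xi>: "\<xi> \<in> parabola_slab i j c \<rho>"
  shows "\<bar>\<xi> $ j + 1 / 2\<bar> \<le> 2 * c / \<rho>\<^sup>2"
proof -
  have "\<bar>\<xi> $ i + 1 / 2\<bar> \<le> c / \<rho>" and b: "\<bar>\<xi> $ j + 1 / 2 - (\<xi> $ i + 1 / 2)\<^sup>2\<bar> \<le> c / \<rho> ^ 4"
    using \<xi> by (auto simp: parabola_slab_def)
  then have "(\<xi> $ i + 1 / 2)\<^sup>2 \<le> (c / \<rho>)\<^sup>2"
    using power_mono[of "\<bar>\<xi> $ i + 1 / 2\<bar>" "c / \<rho>" 2] by simp
  also have "\<dots> = c\<^sup>2 / \<rho>\<^sup>2" by (simp add: power_divide)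
  also have "\<dots> \<le> c / \<rho>\<^sup>2"
    using c by (intro divide_right_mono) (auto simp: power2_eq_square mult_left_le)
  finally have "(\<xi> $ i + 1 / 2)\<^sup>2 \<le> c / \<rho>\<^sup>2" .
  moreover have "c / \<rho> ^ 4 \<le> c / \<rho>\<^sup>2"
    using c \<rho> by (intro divide_left_mono power_increasing) auto
  moreover have "(\<xi> $ i + 1 / 2)\<^sup>2 \<ge> 0" by simp
  moreover have "2 * c / \<rho>\<^sup>2 = c / \<rho>\<^sup>2 + c / \<rho>\<^sup>2" by simp
  ultimately show ?thesis using b by linarith
qed

lemma parabola_slab_subset:
  fixes i j :: "'n::finite"
  assumes ij: "i \<noteq> j" and c: "0 < c" "c \<le> 1" and \<rho>: "\<rho> \<ge> 1" and \<epsilon>: "4 * real CARD('n) * c \<le> \<epsilon>"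
  shows "parabola_slab i j c \<rho> \<subseteq> {\<xi>. norm (2 *\<^sub>R \<xi> + axis i 1 + axis j 1) \<le> \<epsilon>}"
proof
  fix \<xi> :: "real ^ 'n" assume \<xi>: "\<xi> \<in> parabola_slab i j c \<rho>"
  have d: "c / \<rho> \<le> c" "c / \<rho>\<^sup>2 \<le> c"
    using divide_scale_le[OF c(1) \<rho>, of 1] divide_scale_le[OF c(1) \<rho>, of 2] by simp_all
  have i: "\<bar>\<xi> $ i + 1 / 2\<bar> \<le> c / \<rho>" and k: "\<And>k. k \<noteq> i \<Longrightarrow> k \<noteq> j \<Longrightarrow> \<bar>\<xi> $ k\<bar> \<le> c / \<rho>\<^sup>2"
    using \<xi> by (auto simp: parabola_slab_def)
  have "\<bar>(2 *\<^sub>R \<xi> + axis i 1 + axis j 1) $ k\<bar> \<le> 4 * c" for k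
  proof -
    consider "k = i" | "k = j" | "k \<noteq> i" "k \<noteq> j" by blast
    then show ?thesis
    proof cases
      case 1
      then have "(2 *\<^sub>R \<xi> + axis i 1 + axis j 1) $ k = 2 * (\<xi> $ i + 1 / 2)" using ij by (simp add: axis_def)
      with i d c show ?thesis by simp
    next
      case 2
      then have "(2 *\<^sub>R \<xi> + axis i 1 + axis j 1) $ k = 2 * (\<xi> $ j + 1 / 2)" using ij by (simp add: axis_def)
      with parabola_slab_height[OF c \<rho> \<xi>] d c show ?thesis by simp
    next
      case 3
      then have "(2 *\<^sub>R \<xi> + axis i 1 + axis j 1) $ k = 2 * \<xi> $ k" by (simp add: axis_def)
      with k[OF 3] d c show ?thesis by simp
    qed
  qed
  then have "(\<Sum>k\<in>UNIV. \<bar>(2 *\<^sub>R \<xi> + axis i 1 + axis j 1) $ k\<bar>) \<le> real CARD('n) * (4 * c)"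
    by (rule sum_bounded_above)
  with norm_le_l1_cart[of "2 *\<^sub>R \<xi> + axis i 1 + axis j 1"] \<epsilon>
  show "\<xi> \<in> {\<xi>. norm (2 *\<^sub>R \<xi> + axis i 1 + axis j 1) \<le> \<epsilon>}" by simp
qed

text \<open>Each term of the phases is a product of a space-time variable of size \<open>a\<close> and a frequency variable of the dual size.\<close>

lemma abs_mult_scale_le:
  fixes x y :: real
  assumes "\<bar>x\<bar> \<le> a" "\<bar>y\<bar> \<le> b / a" "a > 0"
  shows "\<bar>x * y\<bar> \<le> b"
proof -
  have "\<bar>x * y\<bar> \<le> a * (b / a)" unfolding abs_mult using assms by (intro mult_mono) auto
  with assms show ?thesis by simp
qed

text \<open>In the moving frame the phase splits into three kinds of terms: \<open>(x_i + t) (\<xi>_i - 1)\<close>, the transversal terms, and the dispersive term \<open>t (|\<xi>| - \<xi>_i)\<close>, which is controlled by \<open>(|\<xi>| - \<xi>_i) (|\<xi>| + \<xi>_i)\<close>, the square of the transversal part of \<open>\<xi>\<close>.\<close>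

lemma wave_phase:
  fixes i :: "'n::finite"
  assumes c: "0 < c" "10 * real CARD('n) * c \<le> 1" and \<rho>: "\<rho> \<ge> 1" and t: "0 \<le> t" "t \<le> \<rho> ^ 4"
    and x: "x \<in> comoving_box i \<rho> t" and \<xi>: "\<xi> \<in> wave_box i c \<rho>"
  shows "\<bar>x \<bullet> \<xi> + t * norm \<xi> - (x $ i + t)\<bar> \<le> 1"
proof -
  define d where "d = real CARD('n)"
  have d: "d \<ge> 1" unfolding d_def by (simp add: Suc_leI)
  have dc: "10 * (d * c) \<le> 1" using c by (simp add: d_def)
  have "c \<le> d * c" using d c by simp
  then have c1: "c \<le> 1 / 10" using dc by simp
  have xi: "\<bar>x $ i + t\<bar> \<le> \<rho>" and xk: "\<And>k. k \<noteq> i \<Longrightarrow> \<bar>x $ k\<bar> \<le> \<rho>\<^sup>2"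
    using x by (auto simp: comoving_box_def)
  have \<xi>i: "\<bar>\<xi> $ i - 1\<bar> \<le> c / \<rho>" and \<xi>k: "\<And>k. k \<noteq> i \<Longrightarrow> \<bar>\<xi> $ k\<bar> \<le> c / \<rho>\<^sup>2"
    using \<xi> by (auto simp: wave_box_def axis_def dest: spec split: if_splits)
  define S1 where "S1 = (\<Sum>k\<in>UNIV - {i}. x $ k * \<xi> $ k)"
  define S2 where "S2 = (\<Sum>k\<in>UNIV - {i}. (\<xi> $ k)\<^sup>2)"
  have S1: "\<bar>S1\<bar> \<le> d * c"
    unfolding S1_def d_def using c \<rho> by (intro abs_sum_le_card abs_mult_scale_le[OF xk \<xi>k]) auto
  have "\<bar>S2\<bar> \<le> d * (c / \<rho>\<^sup>2)\<^sup>2"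
    unfolding S2_def d_def
    using power_mono[OF \<xi>k abs_ge_zero, of _ 2] by (intro abs_sum_le_card) auto
  then have S2: "\<bar>S2\<bar> \<le> (d * c\<^sup>2) / \<rho> ^ 4" by (simp add: power_divide flip: power_mult)
  have S2n: "S2 \<ge> 0" unfolding S2_def by (intro sum_nonneg) auto
  have in1: "x \<bullet> \<xi> = x $ i * \<xi> $ i + S1"
    unfolding inner_vec_def S1_def by (subst sum.remove[of _ i]) auto
  have nn: "(norm \<xi>)\<^sup>2 = (\<xi> $ i)\<^sup>2 + S2"
    unfolding power2_norm_eq_inner inner_vec_def S2_def by (subst sum.remove[of _ i]) (auto simp: power2_eq_square)
  have "c / \<rho> \<le> c" using divide_scale_le[OF c(1) \<rho>, of 1] by simp
  then have half: "\<xi> $ i \<ge> 1 / 2" using \<xi>i c1 by (simp add: abs_le_iff)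
  have ge: "\<xi> $ i \<le> norm \<xi>" using component_le_norm_cart[of \<xi> i] by simp
  have "(norm \<xi> - \<xi> $ i) * 1 \<le> (norm \<xi> - \<xi> $ i) * (norm \<xi> + \<xi> $ i)"
    using ge half by (intro mult_left_mono) auto
  also have "\<dots> = S2" using nn by (simp add: power2_eq_square algebra_simps)
  finally have gap: "\<bar>norm \<xi> - \<xi> $ i\<bar> \<le> (d * c\<^sup>2) / \<rho> ^ 4" using ge S2 by simp
  have T2: "\<bar>t * (norm \<xi> - \<xi> $ i)\<bar> \<le> d * c\<^sup>2"
    using t \<rho> by (intro abs_mult_scale_le[OF _ gap]) auto
  have T1: "\<bar>(x $ i + t) * (\<xi> $ i - 1)\<bar> \<le> c"
    using \<rho> by (intro abs_mult_scale_le[OF xi \<xi>i]) auto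
  have "d * c\<^sup>2 \<le> d * c" using c1 c d by (intro mult_left_mono) (auto simp: power2_eq_square mult_left_le)
  moreover have "x \<bullet> \<xi> + t * norm \<xi> - (x $ i + t) = (x $ i + t) * (\<xi> $ i - 1) + t * (norm \<xi> - \<xi> $ i) + S1"
    unfolding in1 by (simp add: algebra_simps)
  ultimately show ?thesis using T1 T2 S1 dc \<open>c \<le> d * c\<close> by linarith
qed

text \<open>In terms of the offsets \<open>a\<close>, \<open>b\<close> from \<open>- (e_i + e_j) / 2\<close> the phase, up to the constant, is \<open>(x_i + t) a + x_j b + t (b - a^2) - t b^2\<close> plus the contributions of the other coordinates. The coefficient \<open>b - a^2\<close> of \<open>t\<close> is what the slab makes small.\<close>

lemma schroedinger_phase:
  fixes i j :: "'n::finite"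
  assumes ij: "i \<noteq> j" and c: "0 < c" "10 * real CARD('n) * c \<le> 1" and \<rho>: "\<rho> \<ge> 1" and t: "0 \<le> t" "t \<le> \<rho> ^ 4"
    and x: "x \<in> comoving_box i \<rho> t" and \<xi>: "\<xi> \<in> parabola_slab i j c \<rho>"
  shows "\<bar>x \<bullet> \<xi> - t * (norm \<xi>)\<^sup>2 - (- (x $ i + t + x $ j) / 2)\<bar> \<le> 1"
proof -
  define d where "d = real CARD('n)"
  have "card {i, j} \<le> CARD('n)" by (rule card_mono) auto
  then have d: "d \<ge> 2" unfolding d_def using ij by simp
  have dc: "10 * (d * c) \<le> 1" using c by (simp add: d_def)
  have "2 * c \<le> d * c" using d c by simp
  then have c1: "c \<le> 1" using dc by simp
  have xi: "\<bar>x $ i + t\<bar> \<le> \<rho>" and xk: "\<And>k. k \<noteq> i \<Longrightarrow> \<bar>x $ k\<bar> \<le> \<rho>\<^sup>2"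
    using x by (auto simp: comoving_box_def)
  define a where "a = \<xi> $ i + 1 / 2"
  define b where "b = \<xi> $ j + 1 / 2"
  have a: "\<bar>a\<bar> \<le> c / \<rho>" and ba: "\<bar>b - a\<^sup>2\<bar> \<le> c / \<rho> ^ 4"
    and \<xi>k: "\<And>k. k \<noteq> i \<Longrightarrow> k \<noteq> j \<Longrightarrow> \<bar>\<xi> $ k\<bar> \<le> c / \<rho>\<^sup>2"
    using \<xi> by (auto simp: parabola_slab_def a_def b_def)
  have b: "\<bar>b\<bar> \<le> 2 * c / \<rho>\<^sup>2"
    unfolding b_def by (rule parabola_slab_height[OF c(1) c1 \<rho> \<xi>])
  define S1 where "S1 = (\<Sum>k\<in>UNIV - {i} - {j}. x $ k * \<xi> $ k)"
  define S2 where "S2 = (\<Sum>k\<in>UNIV - {i} - {j}. (\<xi> $ k)\<^sup>2)"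
  have S1: "\<bar>S1\<bar> \<le> d * c"
    unfolding S1_def d_def using c \<rho> by (intro abs_sum_le_card abs_mult_scale_le[OF xk \<xi>k]) auto
  have "\<bar>S2\<bar> \<le> d * (c / \<rho>\<^sup>2)\<^sup>2"
    unfolding S2_def d_def
    using power_mono[OF \<xi>k abs_ge_zero, of _ 2] by (intro abs_sum_le_card) auto
  then have S2: "\<bar>S2\<bar> \<le> (d * c\<^sup>2) / \<rho> ^ 4" by (simp add: power_divide flip: power_mult)
  have split: "(\<Sum>k\<in>UNIV. f k) = f i + (f j + (\<Sum>k\<in>UNIV - {i} - {j}. f k))" for f :: "'n \<Rightarrow> real"
    using ij by (subst sum.remove[of _ i], simp, simp, subst sum.remove[of _ j]) auto
  have in1: "x \<bullet> \<xi> = x $ i * (a - 1 / 2) + (x $ j * (b - 1 / 2) + S1)"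
    unfolding inner_vec_def S1_def by (subst split) (simp add: a_def b_def)
  have nn: "(norm \<xi>)\<^sup>2 = (a - 1 / 2)\<^sup>2 + ((b - 1 / 2)\<^sup>2 + S2)"
    unfolding power2_norm_eq_inner inner_vec_def S2_def by (subst split) (simp add: a_def b_def power2_eq_square)
  have "\<bar>b\<^sup>2\<bar> \<le> (2 * c / \<rho>\<^sup>2)\<^sup>2" using power_mono[OF b abs_ge_zero, of 2] by simp
  then have b2: "\<bar>b\<^sup>2\<bar> \<le> (4 * c\<^sup>2) / \<rho> ^ 4" by (simp add: power_divide power_mult_distrib flip: power_mult)
  have T1: "\<bar>(x $ i + t) * a\<bar> \<le> c" using \<rho> by (intro abs_mult_scale_le[OF xi a]) auto
  have T2: "\<bar>x $ j * b\<bar> \<le> 2 * c" using \<rho> ij by (intro abs_mult_scale_le[OF xk b]) auto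
  have t': "\<bar>t\<bar> \<le> \<rho> ^ 4" using t by simp
  have T3: "\<bar>t * (b - a\<^sup>2)\<bar> \<le> c" using \<rho> by (intro abs_mult_scale_le[OF t' ba]) auto
  have T4: "\<bar>t * b\<^sup>2\<bar> \<le> 4 * c\<^sup>2" using \<rho> by (intro abs_mult_scale_le[OF t' b2]) auto
  have T5: "\<bar>t * S2\<bar> \<le> d * c\<^sup>2" using \<rho> by (intro abs_mult_scale_le[OF t' S2]) auto
  have cc: "c\<^sup>2 \<le> c" using c1 c by (auto simp: power2_eq_square mult_left_le)
  then have "d * c\<^sup>2 \<le> d * c" using d by (intro mult_left_mono) auto
  moreover have "x \<bullet> \<xi> - t * (norm \<xi>)\<^sup>2 - (- (x $ i + t + x $ j) / 2)
      = (x $ i + t) * a + x $ j * b + S1 + t * (b - a\<^sup>2) - t * b\<^sup>2 - t * S2"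
    unfolding in1 nn by (simp add: power2_eq_square field_simps)
  ultimately show ?thesis using T1 T2 T3 T4 T5 S1 dc cc \<open>2 * c \<le> d * c\<close> by linarith
qed

lemma powr_bounded_imp_nonpos:
  fixes E K :: real
  assumes "\<And>\<rho>. \<rho> \<ge> 1 \<Longrightarrow> \<rho> powr E \<le> K"
  shows "E \<le> 0"
proof (rule ccontr)
  assume "\<not> E \<le> 0"
  then have E: "E > 0" by simp
  define \<rho> where "\<rho> = (1 + \<bar>K\<bar>) powr (1 / E)"
  have "\<rho> \<ge> 1" unfolding \<rho>_def using E by (intro ge_one_powr_ge_zero) auto
  then have "\<rho> powr E \<le> K" by (rule assms)
  moreover have "\<rho> powr E = 1 + \<bar>K\<bar>" unfolding \<rho>_def using E by (simp add: powr_powr)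
  ultimately show False by linarith
qed

text \<open>For finite exponents, the test at scale \<open>\<rho>\<close> bounds a fixed power of \<open>\<rho>\<close> by a constant, for all \<open>\<rho> \<ge> 1\<close>; so its exponent cannot be positive. The constant \<open>c\<close> is small enough both for the phase bounds and for the prescribed supports.\<close>

lemma bilinear_exponent_condition:
  fixes q r \<epsilon> C :: real and i j :: "'n::finite"
  assumes card: "CARD('n) \<ge> 2" and ij: "i \<noteq> j" and q: "q > 0" and r: "r > 0" and \<epsilon>: "\<epsilon> > 0" and C: "C \<ge> 0"
    and est: "\<And>f g :: real ^ 'n \<Rightarrow> complex. L2_fun f \<Longrightarrow> L2_fun g \<Longrightarrow>
      ess_support (L2_fourier f) \<subseteq> {\<xi>. norm (\<xi> - axis i 1) \<le> \<epsilon>} \<Longrightarrow>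
      ess_support (L2_fourier g) \<subseteq> {\<xi>. norm (2 *\<^sub>R \<xi> + axis i 1 + axis j 1) \<le> \<epsilon>} \<Longrightarrow>
      mixed_norm (ennreal q) (ennreal r) (\<lambda>t x. wave_propagator t f x * schroedinger_propagator t g x)
        \<le> ennreal C * L2_norm f * L2_norm g"
  shows "2 / q + (real CARD('n) - 1 / 2) / r \<le> real CARD('n)"
proof -
  define d where "d = real CARD('n)"
  have d: "d \<ge> 2" using card by (simp add: d_def)
  define c where "c = min 1 \<epsilon> / (10 * d)"
  have c: "c > 0" using d \<epsilon> by (simp add: c_def)
  have "10 * d * c = min 1 \<epsilon>" using d by (simp add: c_def)
  then have dc: "10 * d * c \<le> 1" "10 * d * c \<le> \<epsilon>" by simp_all
  have "1 * c \<le> d * c" using c d by (intro mult_right_mono) auto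
  then have c1: "c \<le> 1" using dc by simp
  have dc0: "d * c \<ge> 0" and dce: "10 * (d * c) \<le> \<epsilon>" using dc c d by simp_all
  obtain m where m: "CARD('n) = m + 2" using card by (metis add.commute le_Suc_ex)
  define K where "K = C * (2 * (2 * pi) ^ DIM(real ^ 'n))\<^sup>2"
  have "\<rho> powr (4 / q + (2 * d - 1) / r - 2 * d) \<le> K / (2 * c) ^ CARD('n)" if \<rho>: "\<rho> \<ge> 1" for \<rho>
  proof -
    have \<rho>0: "\<rho> > 0" using \<rho> by simp
    let ?A = "wave_box i c \<rho>" and ?B = "parabola_slab i j c \<rho>"
    define w where "w = 2 * c / \<rho>\<^sup>2"
    have w: "w > 0" using c \<rho> by (simp add: w_def)
    have A: "emeasure lborel ?A = ennreal (2 * c / \<rho> * w ^ (m + 1))"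
      using emeasure_wave_box[OF c \<rho>0, of i] by (simp add: m w_def)
    have B: "emeasure lborel ?B = ennreal (2 * c / \<rho> ^ 4 * (2 * c / \<rho> * w ^ m))"
      using emeasure_parabola_slab[OF ij c \<rho>0] by (simp add: m w_def)
    have mA: "measure lborel ?A = 2 * c / \<rho> * w ^ (m + 1)"
      using A w c \<rho>0 by (simp add: measure_def)
    have mB: "measure lborel ?B = 2 * c / \<rho> ^ 4 * (2 * c / \<rho> * w ^ m)"
      using B w c \<rho>0 by (simp add: measure_def)
    \<comment> \<open>The width \<open>1 / \<rho>\<close>, which occurs in both sets, and the thickness \<open>1 / \<rho>^4\<close> of the slab together amount to three factors of the width \<open>w\<close>, so only powers of \<open>w\<close> remain.\<close>
    have w3: "(2 * c / \<rho>) * (2 * c / \<rho> ^ 4) * (2 * c / \<rho>) = w ^ 3"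
      by (simp add: w_def power_divide power3_eq_cube power2_eq_square power4_eq_xxxx)
    have "measure lborel ?A * measure lborel ?B = w ^ 3 * (w ^ (m + 1) * w ^ m)"
      unfolding mA mB w3[symmetric] by (simp only: mult_ac)
    also have "\<dots> = (w ^ (m + 2))\<^sup>2"
      by (simp add: power2_eq_square power3_eq_cube mult_ac)
    finally have AB: "sqrt (measure lborel ?A * measure lborel ?B) = w ^ (m + 2)"
      using w by simp
    define v where "v = 2 * \<rho> * (2 * \<rho>\<^sup>2) ^ (CARD('n) - 1)"
    have v: "v \<ge> \<rho> powr (2 * d - 1)"
    proof -
      have "\<rho> powr (2 * d - 1) = \<rho> powr real (1 + 2 * (CARD('n) - 1))"
        by (simp add: d_def m)
      also have "\<dots> = \<rho> * (\<rho>\<^sup>2) ^ (CARD('n) - 1)"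
        using \<rho>0 by (subst powr_realpow) (auto simp: power_add power_mult)
      also have "\<dots> \<le> v"
        unfolding v_def using \<rho>0 by (intro mult_mono power_mono) auto
      finally show ?thesis .
    qed
    have v0: "v \<ge> 0" using \<rho>0 by (simp add: v_def)
    have "sqrt (measure lborel ?A * measure lborel ?B) * v powr (1 / r) * (\<rho> ^ 4) powr (1 / q) \<le> K"
      unfolding K_def
    proof (rule bilinear_estimate_test[where I = "{0..\<rho> ^ 4}" and V = "comoving_box i \<rho>"])
      show "?A \<in> sets borel" "?B \<in> sets borel"
        using wave_box_borel[OF c \<rho>0] parabola_slab_borel[OF ij c \<rho>0] by auto
      show "emeasure lborel ?A < \<infinity>" "emeasure lborel ?B < \<infinity>" unfolding A B by simp_all
      show "measure lborel ?A > 0" "measure lborel ?B > 0" unfolding mA mB using w c \<rho>0 by simp_all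
      show "emeasure lborel {0..\<rho> ^ 4} = ennreal (\<rho> ^ 4)" using \<rho>0 by simp
      show "comoving_box i \<rho> t \<in> sets borel" "emeasure lborel (comoving_box i \<rho> t) = ennreal v" for t
        unfolding v_def using comoving_box_borel[OF \<rho>0] emeasure_comoving_box[OF \<rho>0] by auto
      fix t x assume t: "t \<in> {0..\<rho> ^ 4}" and x: "x \<in> comoving_box i \<rho> t"
      show "\<exists>\<theta>. \<forall>\<xi>\<in>?A. \<bar>x \<bullet> \<xi> + t * norm \<xi> - \<theta>\<bar> \<le> 1"
        using wave_phase[OF c _ \<rho> _ _ x] t dc by (auto simp: d_def)
      show "\<exists>\<theta>. \<forall>\<xi>\<in>?B. \<bar>x \<bullet> \<xi> - t * (norm \<xi>)\<^sup>2 - \<theta>\<bar> \<le> 1"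
        using schroedinger_phase[OF ij c _ \<rho> _ _ x] t dc unfolding d_def by (meson atLeastAtMost_iff)
    next
      show "?A \<subseteq> {\<xi>. norm (\<xi> - axis i 1) \<le> \<epsilon>}"
        using dce dc0 by (intro wave_box_subset c \<rho>) (simp add: d_def[symmetric])
      show "?B \<subseteq> {\<xi>. norm (2 *\<^sub>R \<xi> + axis i 1 + axis j 1) \<le> \<epsilon>}"
        using dce dc0 by (intro parabola_slab_subset ij c c1 \<rho>) (simp add: d_def[symmetric])
      show "closed {\<xi> :: real ^ 'n. norm (\<xi> - axis i 1) \<le> \<epsilon>}"
        "closed {\<xi> :: real ^ 'n. norm (2 *\<^sub>R \<xi> + axis i 1 + axis j 1) \<le> \<epsilon>}"
        by (intro closed_Collect_le continuous_intros)+
    qed (use q r C v0 \<rho>0 est in auto)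
    then have est: "w ^ CARD('n) * v powr (1 / r) * (\<rho> ^ 4) powr (1 / q) \<le> K"
      unfolding AB m .
    have "(2 * c) ^ CARD('n) * \<rho> powr (4 / q + (2 * d - 1) / r - 2 * d)
      = w ^ CARD('n) * (\<rho> powr (2 * d - 1)) powr (1 / r) * (\<rho> ^ 4) powr (1 / q)"
    proof -
      have "(\<rho>\<^sup>2) ^ CARD('n) = \<rho> ^ (2 * CARD('n))" by (rule power_mult[symmetric])
      also have "\<dots> = \<rho> powr real (2 * CARD('n))" by (rule powr_realpow[OF \<rho>0, symmetric])
      also have "real (2 * CARD('n)) = 2 * d" by (simp add: d_def)
      finally have \<rho>2: "(\<rho>\<^sup>2) ^ CARD('n) = \<rho> powr (2 * d)" .
      have "w ^ CARD('n) = (2 * c) ^ CARD('n) * \<rho> powr (- (2 * d))"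
        by (simp only: w_def power_divide \<rho>2 powr_minus_divide times_divide_eq_right mult_1_right)
      moreover have "(\<rho> ^ 4) powr (1 / q) = \<rho> powr (4 / q)"
      proof -
        have "(\<rho> powr real 4) powr (1 / q) = \<rho> powr (4 / q)" by (simp add: powr_powr del: powr_numeral)
        then show ?thesis by (simp only: powr_realpow[OF \<rho>0])
      qed
      moreover have "\<rho> powr (4 / q + (2 * d - 1) / r - 2 * d)
          = \<rho> powr (- (2 * d)) * \<rho> powr ((2 * d - 1) / r) * \<rho> powr (4 / q)"
        by (simp add: powr_add[symmetric] algebra_simps)
      ultimately show ?thesis by (simp add: powr_powr)
    qed
    also have "\<dots> \<le> w ^ CARD('n) * v powr (1 / r) * (\<rho> ^ 4) powr (1 / q)"
      using v w r by (intro mult_right_mono mult_left_mono powr_mono2) auto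
    also note est
    finally show ?thesis using c by (simp add: pos_le_divide_eq mult.commute)
  qed
  then have "4 / q + (2 * d - 1) / r - 2 * d \<le> 0"
    by (rule powr_bounded_imp_nonpos)
  then show ?thesis unfolding d_def[symmetric] using q r by (simp add: field_simps)
qed

theorem theorem3:
  fixes q r :: ennreal and \<epsilon> :: real and i j :: "'n::finite"
  assumes "CARD('n) \<ge> 2" and "i \<noteq> j"
    and "1 \<le> q" and "1 \<le> r" and "\<epsilon> > 0"
    and "\<exists>C>0. \<forall>f g :: real ^ 'n \<Rightarrow> complex.
      L2_fun f \<longrightarrow> L2_fun g \<longrightarrow>
      ess_support (L2_fourier f) \<subseteq> {\<xi>. norm (\<xi> - axis i 1) \<le> \<epsilon>} \<longrightarrow>
      ess_support (L2_fourier g) \<subseteq> {\<xi>. norm (2 *\<^sub>R \<xi> + axis i 1 + axis j 1) \<le> \<epsilon>} \<longrightarrow>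
      mixed_norm q r (\<lambda>t x. wave_propagator t f x * schroedinger_propagator t g x)
        \<le> ennreal C * L2_norm f * L2_norm g"
  shows "2 / q + of_nat (CARD('n) - 1) / r + 1 / (2 * r) \<le> of_nat CARD('n)"
proof -
  define d where "d = real CARD('n)"
  have d: "d \<ge> 2" using assms(1) by (simp add: d_def)
  have nat: "of_nat (CARD('n) - 1) = ennreal (d - 1)" "of_nat CARD('n) = ennreal d"
    using assms(1) by (simp_all add: d_def ennreal_of_nat_eq_real_of_nat of_nat_diff)
  have two_divide: "2 / ennreal y = ennreal (2 / y)" if "y \<ge> 1" for y
    using that divide_ennreal[of 2 y] by simp
  show ?thesis
  proof (cases r)
    case top
    have "2 / q \<le> ennreal d"
    proof (cases q)
      case q': (real q')
      have q1: "q' \<ge> 1" using assms(3) unfolding q' by (simp add: q')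
      then have "2 / q' \<le> 2" by (simp add: divide_le_eq)
      then show ?thesis unfolding q' two_divide[OF q1] using d by (intro ennreal_leI) simp
    qed simp
    then show ?thesis unfolding nat top by simp
  next
    case r': (real r')
    have r1: "r' \<ge> 1" using assms(4) unfolding r' by (simp add: r')
    have tr: "of_nat (CARD('n) - 1) / r + 1 / (2 * r) = ennreal ((d - 1 / 2) / r')"
    proof -
      have "of_nat (CARD('n) - 1) / r + 1 / (2 * r) = ennreal ((d - 1) / r' + 1 / (2 * r'))"
      proof -
        have "2 * ennreal r' = ennreal (2 * r')" using r1 by (simp add: ennreal_mult)
        then have "1 / (2 * ennreal r') = ennreal (1 / (2 * r'))"
          using r1 divide_ennreal[of 1 "2 * r'"] by simp
        moreover have "ennreal (d - 1) / ennreal r' = ennreal ((d - 1) / r')"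
          using r1 d by (intro divide_ennreal) auto
        ultimately show ?thesis
          unfolding nat r' using r1 d by (subst ennreal_plus) auto
      qed
      also have "(d - 1) / r' + 1 / (2 * r') = (d - 1 / 2) / r'"
        using r1 by (simp add: field_simps)
      finally show ?thesis .
    qed
    show ?thesis
    proof (cases q)
      case top
      have "(d - 1 / 2) / r' \<le> (d - 1 / 2) / 1" using r1 d by (intro divide_left_mono) auto
      then have "(d - 1 / 2) / r' \<le> d" by simp
      then show ?thesis unfolding add.assoc unfolding tr unfolding nat top by (simp add: ennreal_leI)
    next
      case q': (real q')
      have q1: "q' \<ge> 1" using assms(3) unfolding q' by (simp add: q')
      from assms(6) obtain C where C: "C > 0" and est: "\<And>f g :: real ^ 'n \<Rightarrow> complex.
        L2_fun f \<Longrightarrow> L2_fun g \<Longrightarrow>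
        ess_support (L2_fourier f) \<subseteq> {\<xi>. norm (\<xi> - axis i 1) \<le> \<epsilon>} \<Longrightarrow>
        ess_support (L2_fourier g) \<subseteq> {\<xi>. norm (2 *\<^sub>R \<xi> + axis i 1 + axis j 1) \<le> \<epsilon>} \<Longrightarrow>
        mixed_norm (ennreal q') (ennreal r') (\<lambda>t x. wave_propagator t f x * schroedinger_propagator t g x)
          \<le> ennreal C * L2_norm f * L2_norm g"
        unfolding q' r' by blast
      have "2 / q' + (d - 1 / 2) / r' \<le> d"
        unfolding d_def
        by (rule bilinear_exponent_condition[OF assms(1,2) _ _ assms(5) _ est]) (use q1 r1 C in auto)
      moreover have "2 / q + of_nat (CARD('n) - 1) / r + 1 / (2 * r) = ennreal (2 / q' + (d - 1 / 2) / r')"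
        unfolding add.assoc unfolding tr unfolding q' two_divide[OF q1] using q1 r1 d by (subst ennreal_plus) auto
      ultimately show ?thesis unfolding nat by (simp add: ennreal_leI)
    qed
  qed
qed

end
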